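(* Let $F\in\mathbb{D}^{1,2}$ with $\mathbb{E}[F]=0$, $\operatorname{Var}(F)=1$, such that $Ff_z(F)+\mathbf 1\{F>z\}\in\mathbb{D}^{1,2}$ for all $z\in\mathbb{R}$ and $u:=\big(\frac{1}{\sqrt{p_kq_k}}D_kF\,|D_kL^{-1}F|\big)_{k\in\mathbb{N}}\in\operatorname{Dom}(\delta)$. Assume there exist a constant $A>0$ and increasing functions $\gamma_1,\gamma_2$ such that $\mathbb{E}[e^{tF}]<\infty$ and $$\text{(A1)}\quad \mathbb{E}\big[|1-\langle DF,-DL^{-1}F\rangle|\,e^{tF}\big]\le\gamma_1(t)\,\mathbb{E}[e^{tF}],\qquad \text{(A2)}\quad \mathbb{E}\big[|\delta(u)|\,e^{tF}\big]\le\gamma_2(t)\,\mathbb{E}[e^{tF}]$$ for all $0\le t\le A$. For $d_0\ge0$ let $A_0(d_0):=\max\{0\le t\le A: \frac{t^2}{2}(\gamma_1(t)+\gamma_2(t))\le d_0\}$. Then for any $d_0\ge0$, $$\Big|\frac{\mathbb{P}(F>z)}{1-\Phi(z)}-1\Big|\le 25\,e^{d_0}(1+z^2)\big(\gamma_1(z)+\gamma_2(z)\big)$$ provided $0\le z\le A_0(d_0)$.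
   Context: $X=(X_k)_{k\in\mathbb{N}}$ are independent Rademacher variables with $\mathbb{P}(X_k=1)=p_k\in(0,1)$, $\mathbb{P}(X_k=-1)=q_k=1-p_k$; $Y_k=(X_k-p_k+q_k)/(2\sqrt{p_kq_k})$. For $F=f(X)\in L^2(\Omega,\sigma(X),\mathbb{P})$, $F_k^\pm$ is $f$ evaluated with $X_k$ replaced by $\pm1$, and $D_kF:=\sqrt{p_kq_k}(F_k^+-F_k^-)$, $DF=(D_kF)_k$. $\mathbb{D}^{1,2}=\{F\in L^2(\Omega,\sigma(X),\mathbb{P}):\mathbb{E}\sum_k(D_kF)^2<\infty\}$. $\delta$ is the adjoint of $D$: $u\in\operatorname{Dom}(\delta)$ and $\mathbb{E}[\langle DG,u\rangle]=\mathbb{E}[G\delta(u)]$ for all $G\in\mathbb{D}^{1,2}$, with $\langle a,b\rangle=\sum_k a_kb_k$. Every such $F$ has the chaos expansion $F=\mathbb{E}F+\sum_{n\ge1}J_n(f_n)$, $J_n(f_n)=\sum_{(i_1,\dots,i_n)}f_n(i_1,\dots,i_n)Y_{i_1}\cdots Y_{i_n}\mathbf 1\{i_j\ne i_k,\ j\ne k\}$, and $L^{-1}F:=-\sum_{n\ge1}\frac1nJ_n(f_n)$. $\Phi$ and $p(w)=e^{-w^2/2}/\sqrt{2\pi}$ are the standard normal distribution function and density, and $f_z$ is the solution of the Stein equation $f_z'(w)-wf_z(w)=\mathbf 1\{w\le z\}-\Phi(z)$: $f_z(w)=\Phi(w)(1-\Phi(z))/p(w)$ for $w\le z$ and $f_z(w)=\Phi(z)(1-\Phi(w))/p(w)$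 for $w>z$. *)

theory Defs
  imports "HOL-Probability.Probability"
begin

text \<open>Canonical Rademacher space: \<omega> :: nat \<Rightarrow> real, with X_k(\<omega>) = \<omega> k,
  coordinates independent, P(X_k = 1) = p k, P(X_k = -1) = 1 - p k.\<close>

definition rad_pmf :: "(nat \<Rightarrow> real) \<Rightarrow> nat \<Rightarrow> real pmf" where
  "rad_pmf p k = map_pmf (\<lambda>b. if b then 1 else -1) (bernoulli_pmf (p k))"

definition RadM :: "(nat \<Rightarrow> real) \<Rightarrow> (nat \<Rightarrow> real) measure" where
  "RadM p = PiM UNIV (\<lambda>k. measure_pmf (rad_pmf p k))"

definition qq :: "(nat \<Rightarrow> real) \<Rightarrow> nat \<Rightarrow> real" where
  "qq p k = 1 - p k"

definition Yv :: "(nat \<Rightarrow> real) \<Rightarrow> nat \<Rightarrow> (nat \<Rightarrow> real) \<Rightarrow> real" where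
  "Yv p k \<omega> = (\<omega> k - p k + qq p k) / (2 * sqrt (p k * qq p k))"

definition YA :: "(nat \<Rightarrow> real) \<Rightarrow> nat set \<Rightarrow> (nat \<Rightarrow> real) \<Rightarrow> real" where
  "YA p A \<omega> = (\<Prod>i\<in>A. Yv p i \<omega>)"

definition Dk :: "(nat \<Rightarrow> real) \<Rightarrow> nat \<Rightarrow> ((nat \<Rightarrow> real) \<Rightarrow> real) \<Rightarrow> (nat \<Rightarrow> real) \<Rightarrow> real" where
  "Dk p k F \<omega> = sqrt (p k * qq p k) * (F (fun_upd \<omega> k 1) - F (fun_upd \<omega> k (-1)))"

definition D12 :: "(nat \<Rightarrow> real) \<Rightarrow> ((nat \<Rightarrow> real) \<Rightarrow> real) set" where
  "D12 p = {F. F \<in> borel_measurable (RadM p) \<and> integrable (RadM p) (\<lambda>\<omega>. (F \<omega>)\<^sup>2) \<and>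
      (\<integral>\<^sup>+ \<omega>. (\<Sum>k. ennreal ((Dk p k F \<omega>)\<^sup>2)) \<partial>RadM p) < \<infinity>}"

text \<open>u \<in> Dom(delta) with delta(u) = V: u square integrable on Omega x N, V square integrable,
  and the duality relation E<DG,u> = E[G V] for all G in D^{1,2}.\<close>
definition is_delta :: "(nat \<Rightarrow> real) \<Rightarrow> (nat \<Rightarrow> (nat \<Rightarrow> real) \<Rightarrow> real) \<Rightarrow> ((nat \<Rightarrow> real) \<Rightarrow> real) \<Rightarrow> bool" where
  "is_delta p u V \<longleftrightarrow>
     (\<forall>k. u k \<in> borel_measurable (RadM p)) \<and>
     (\<integral>\<^sup>+ \<omega>. (\<Sum>k. ennreal ((u k \<omega>)\<^sup>2)) \<partial>RadM p) < \<infinity> \<and>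
     V \<in> borel_measurable (RadM p) \<and> integrable (RadM p) (\<lambda>\<omega>. (V \<omega>)\<^sup>2) \<and>
     (\<forall>G \<in> D12 p. (\<integral>\<omega>. (\<Sum>k. Dk p k G \<omega> * u k \<omega>) \<partial>RadM p) = (\<integral>\<omega>. G \<omega> * V \<omega> \<partial>RadM p))"

text \<open>G = L^{-1} F: by the chaos expansion, F = E F + sum_n J_n(f_n) with
  J_n(f_n) = sum_{|A| = n} E[F Y_A] Y_A (the Y_A form an orthonormal basis),
  and L^{-1} F = - sum_{n>=1} (1/n) J_n(f_n).  G is thus the (a.e. unique) square
  integrable variable whose chaos coefficients are these.\<close>
definition is_Linv :: "(nat \<Rightarrow> real) \<Rightarrow> ((nat \<Rightarrow> real) \<Rightarrow> real) \<Rightarrow> ((nat \<Rightarrow> real) \<Rightarrow> real) \<Rightarrow> bool" where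
  "is_Linv p F G \<longleftrightarrow>
     G \<in> borel_measurable (RadM p) \<and> integrable (RadM p) (\<lambda>\<omega>. (G \<omega>)\<^sup>2) \<and>
     (\<forall>A. finite A \<longrightarrow>
        (\<integral>\<omega>. G \<omega> * YA p A \<omega> \<partial>RadM p) =
        (if A = {} then 0 else - (1 / real (card A)) * (\<integral>\<omega>. F \<omega> * YA p A \<omega> \<partial>RadM p)))"

definition Phi :: "real \<Rightarrow> real" where
  "Phi z = (LBINT x:{..z}. std_normal_density x)"

definition fz :: "real \<Rightarrow> real \<Rightarrow> real" where
  "fz z w = (if w \<le> z then Phi w * (1 - Phi z) / std_normal_density w
             else Phi z * (1 - Phi w) / std_normal_density w)"

definition A0set :: "real \<Rightarrow> (real \<Rightarrow> real) \<Rightarrow> (real \<Rightarrow> real) \<Rightarrow> real \<Rightarrow> real set" where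
  "A0set A \<gamma>1 \<gamma>2 d0 = {t. 0 \<le> t \<and> t \<le> A \<and> t\<^sup>2 / 2 * (\<gamma>1 t + \<gamma>2 t) \<le> d0}"

end

theory Submission
  imports Defs
begin

text \<open>Write \<open>T = 1 - \<langle>DF, - D L\<^sup>-\<^sup>1 F\<rangle>\<close>. If \<open>\<phi>\<close> has derivative \<open>\<psi>\<close> whose increments are dominated by those of a
  nondecreasing function \<open>H\<close>, then \<open>D\<^sub>k \<phi>(F)\<close> differs from \<open>\<psi>(F) D\<^sub>k F\<close> by at most
  \<open>(p\<^sub>k q\<^sub>k)\<^bsup>-1/2\<^esup> D\<^sub>k F D\<^sub>k H(F)\<close>, because \<open>F\<close> is one of \<open>F\<^sub>k\<^sup>+\<close>, \<open>F\<^sub>k\<^sup>-\<close>. Integration by parts and the duality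
  defining \<open>\<delta>(u)\<close> turn this into
  \<open>\<bar>E[F \<phi>(F)] - E[\<psi>(F) (1 - T)]\<bar> \<le> E[H(F) \<delta>(u)]\<close>.
  With \<open>\<phi>\<close> a truncated exponential this is a differential inequality for \<open>E[e\<^sup>t\<^sup>F]\<close>, which yields
  \<open>E[e\<^sup>t\<^sup>F] \<le> e\<^bsup>d\<^sub>0 + t\<^sup>2/2\<^esup>\<close> for \<open>t \<le> A\<^sub>0(d\<^sub>0)\<close>. With \<open>\<phi> = f\<^sub>z\<close> and \<open>H(w) = w f\<^sub>z(w) + 1{w > z}\<close> it bounds
  \<open>P(F > z) - (1 - \<Phi>(z))\<close> by \<open>E[(\<bar>T\<bar> + \<bar>\<delta>(u)\<bar>) b(F)]\<close>, where the weight \<open>b\<close> is dominated by a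
  combination of the exponentials \<open>e\<^sup>t\<^sup>w\<close>, \<open>0 \<le> t \<le> z\<close>, controlled by (A1) and (A2).
  Integration by parts itself only needs Parseval's identity for the orthonormal system \<open>Y\<^sub>A\<close>.\<close>

section \<open>The Rademacher space and its chaos coefficients\<close>

text \<open>\<open>Dk\<close> is a finite difference, so linearising \<phi>(F) leaves an error
  without a definite sign. Measuring it by increments of a nondecreasing \<open>H\<close> makes
  \<open>Dk F\<close> and \<open>Dk H(F)\<close> agree in sign: the bound needs no absolute value
  around them and is linear in \<open>Dk H(F)\<close>. Only the sign of \<open>Dk G\<close> stays
  uncontrolled, which is why u contains |D_k L^{-1}F|; summed over k the bound is then exactly a
  duality pairing. The obstacle is that \<open>H(F)\<close> must lie in \<open>D12\<close>.
  Exponentials are not Lipschitz, hence their linear continuation and a passage to the limit by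
  Fatou; for f_z the function \<open>H\<close> jumps at z, hence the assumption on F f_z(F) + 1{F >
  z}. The moment bound avoids differentiating under the expectation: convexity of exp gives a
  difference inequality that remains valid at the endpoint t = A. The factor 1 + z^2 has two
  sources: the roughly z unit intervals, each of weight of order z, on which e^{w^2/2} is replaced
  by exponentials, and the comparison of e^{-z^2/2} with 1 - Phi(z) through the Mills ratio.\<close>

locale rademacher =
  fixes p :: "nat \<Rightarrow> real"
  assumes p_pos: "0 < p k" and p_less_1: "p k < 1"
begin

abbreviation "M \<equiv> RadM p"

sublocale prob_space M
  unfolding RadM_def by (intro prob_space_PiM) (simp add: measure_pmf.prob_space_axioms)

lemma space_M [simp]: "space M = UNIV"
  by (simp add: RadM_def space_PiM PiE_UNIV_domain)

lemma upd_measurable [measurable]: "(\<lambda>w. w(k := s)) \<in> measurable M M"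
  unfolding RadM_def by (rule measurable_fun_upd[where J=UNIV]) auto

lemma coord_measurable [measurable]: "(\<lambda>w. w k) \<in> borel_measurable M"
proof -
  have "(\<lambda>w. w k) \<in> measurable M (measure_pmf (rad_pmf p k))"
    unfolding RadM_def by (rule measurable_component_singleton) simp
  moreover have "(\<lambda>x. x) \<in> measurable (measure_pmf (rad_pmf p k)) borel"
    by simp
  ultimately show ?thesis by (rule measurable_compose)
qed

text \<open>The underlying space consists of all real sequences, so two-valuedness is only an almost
  sure fact. It is what makes \<open>F w\<close> coincide with one of its two modified
  values.\<close>

lemma AE_coord: "AE w in M. w k = 1 \<or> w k = -1"
proof -
  have "AE x in measure_pmf (rad_pmf p k). x = 1 \<or> x = -1"
    by (auto simp: AE_measure_pmf_iff rad_pmf_def)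
  then show ?thesis
    unfolding RadM_def by (intro AE_PiM_component) (auto simp: measure_pmf.prob_space_axioms)
qed

text \<open>Resampling one coordinate independently preserves the law. This is the form of
  independence behind every computation that integrates out coordinate \<open>k\<close>.\<close>

lemma distr_upd: "distr (measure_pmf (rad_pmf p k) \<Otimes>\<^sub>M M) M (\<lambda>(x, w). w(k := x)) = M"
  using distr_pair_PiM_eq_PiM[of UNIV "\<lambda>k. measure_pmf (rad_pmf p k)" k]
  by (simp add: RadM_def measure_pmf.prob_space_axioms)

lemma upd_pair_measurable [measurable]:
  "(\<lambda>(x, w). w(k := x)) \<in> measurable (measure_pmf (rad_pmf p k) \<Otimes>\<^sub>M M) M"
  unfolding RadM_def case_prod_beta' by (rule measurable_fun_upd[where J=UNIV]) auto

lemma nn_integral_split: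
  assumes [measurable]: "f \<in> borel_measurable M"
  shows "(\<integral>\<^sup>+w. f w \<partial>M) =
    ennreal (p k) * (\<integral>\<^sup>+w. f (w(k := 1)) \<partial>M) + ennreal (1 - p k) * (\<integral>\<^sup>+w. f (w(k := -1)) \<partial>M)"
proof -
  have "(\<integral>\<^sup>+w. f w \<partial>M) = (\<integral>\<^sup>+w. f w \<partial>distr (measure_pmf (rad_pmf p k) \<Otimes>\<^sub>M M) M (\<lambda>(x, w). w(k := x)))"
    by (simp add: distr_upd)
  also have "\<dots> = (\<integral>\<^sup>+y. f ((snd y)(k := fst y)) \<partial>(measure_pmf (rad_pmf p k) \<Otimes>\<^sub>M M))"
    by (subst nn_integral_distr) (auto simp: case_prod_beta')
  also have "\<dots> = (\<integral>\<^sup>+x. \<integral>\<^sup>+w. f (w(k := x)) \<partial>M \<partial>measure_pmf (rad_pmf p k))"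
    by (subst nn_integral_fst[symmetric]) (auto intro!: measurable_compose[OF upd_pair_measurable[unfolded case_prod_beta'] assms])
  also have "\<dots> = ennreal (p k) * (\<integral>\<^sup>+w. f (w(k := 1)) \<partial>M) + ennreal (1 - p k) * (\<integral>\<^sup>+w. f (w(k := -1)) \<partial>M)"
    using p_pos[of k] p_less_1[of k]
    by (simp add: rad_pmf_def nn_integral_measure_pmf_support[of UNIV] UNIV_bool mult.commute)
  finally show ?thesis .
qed

text \<open>Both atoms of coordinate \<open>k\<close> have positive mass, so a finite total integral
  forces each of the two conditional integrals to be finite.\<close>

lemma integrable_upd:
  fixes f :: "(nat \<Rightarrow> real) \<Rightarrow> real"
  assumes f: "integrable M f" and s: "s = 1 \<or> s = -1"
  shows "integrable M (\<lambda>w. f (w(k := s)))"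
proof -
  have [measurable]: "f \<in> borel_measurable M" using f by auto
  have "(\<integral>\<^sup>+w. ennreal (norm (f w)) \<partial>M) < \<infinity>"
    using f by (simp add: integrable_iff_bounded)
  then have "ennreal (p k) * (\<integral>\<^sup>+w. ennreal (norm (f (w(k := 1)))) \<partial>M) < \<infinity>"
    "ennreal (1 - p k) * (\<integral>\<^sup>+w. ennreal (norm (f (w(k := -1)))) \<partial>M) < \<infinity>"
    by (subst (asm) nn_integral_split[of _ k]; simp add: less_top[symmetric])+
  then have "(\<integral>\<^sup>+w. ennreal (norm (f (w(k := s)))) \<partial>M) < \<infinity>"
    using s p_pos[of k] p_less_1[of k]
    by (auto simp: ennreal_mult_less_top less_top[symmetric] ennreal_mult_eq_top_iff)
  then show ?thesis
    by (intro integrableI_bounded) auto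
qed

lemma integral_split:
  fixes f :: "(nat \<Rightarrow> real) \<Rightarrow> real"
  assumes f: "integrable M f"
  shows "(\<integral>w. f w \<partial>M) = p k * (\<integral>w. f (w(k := 1)) \<partial>M) + (1 - p k) * (\<integral>w. f (w(k := -1)) \<partial>M)"
proof -
  have [measurable]: "f \<in> borel_measurable M" using f by auto
  interpret pair_sigma_finite "measure_pmf (rad_pmf p k)" M
    by unfold_locales
  have "integrable (distr (measure_pmf (rad_pmf p k) \<Otimes>\<^sub>M M) M (\<lambda>(x, w). w(k := x))) f"
    using f by (simp add: distr_upd)
  then have int: "integrable (measure_pmf (rad_pmf p k) \<Otimes>\<^sub>M M) (\<lambda>(x, w). f (w(k := x)))"
    by (subst (asm) integrable_distr_eq) (auto simp: case_prod_beta')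
  have "(\<integral>w. f w \<partial>M) = (\<integral>w. f w \<partial>distr (measure_pmf (rad_pmf p k) \<Otimes>\<^sub>M M) M (\<lambda>(x, w). w(k := x)))"
    by (simp add: distr_upd)
  also have "\<dots> = (\<integral>(x, w). f (w(k := x)) \<partial>(measure_pmf (rad_pmf p k) \<Otimes>\<^sub>M M))"
    by (subst integral_distr) (auto simp: case_prod_beta')
  also have "\<dots> = (\<integral>x. (\<integral>w. f (w(k := x)) \<partial>M) \<partial>measure_pmf (rad_pmf p k))"
    using integral_fst'[OF int] by simp
  also have "\<dots> = p k * (\<integral>w. f (w(k := 1)) \<partial>M) + (1 - p k) * (\<integral>w. f (w(k := -1)) \<partial>M)"
    using p_pos[of k] p_less_1[of k]
    by (simp add: rad_pmf_def)
  finally show ?thesis .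
qed

section \<open>Square integrable variables\<close>

definition L2 :: "((nat \<Rightarrow> real) \<Rightarrow> real) set" where
  "L2 = {f. f \<in> borel_measurable M \<and> integrable M (\<lambda>w. (f w)\<^sup>2)}"

lemma L2_mult_integrable:
  assumes "f \<in> L2" "g \<in> L2"
  shows "integrable M (\<lambda>w. f w * g w)"
proof (rule Bochner_Integration.integrable_bound[of M "\<lambda>w. (f w)\<^sup>2 + (g w)\<^sup>2"])
  show "integrable M (\<lambda>w. (f w)\<^sup>2 + (g w)\<^sup>2)"
    using assms by (auto simp: L2_def)
  show "(\<lambda>w. f w * g w) \<in> borel_measurable M"
    using assms by (auto simp: L2_def)
  have "\<bar>a * b\<bar> \<le> a\<^sup>2 + b\<^sup>2" for a b :: real
  proof -
    have "2 * \<bar>a\<bar> * \<bar>b\<bar> \<le> a\<^sup>2 + b\<^sup>2" "0 \<le> \<bar>a\<bar> * \<bar>b\<bar>"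
      using sum_squares_bound[of "\<bar>a\<bar>" "\<bar>b\<bar>"] by auto
    then show ?thesis unfolding abs_mult by linarith
  qed
  then show "AE w in M. norm (f w * g w) \<le> norm ((f w)\<^sup>2 + (g w)\<^sup>2)"
    by simp
qed

lemma L2_add: "f \<in> L2 \<Longrightarrow> g \<in> L2 \<Longrightarrow> (\<lambda>w. f w + g w) \<in> L2"
proof -
  assume fg: "f \<in> L2" "g \<in> L2"
  have "integrable M (\<lambda>w. (f w)\<^sup>2 + (g w)\<^sup>2 + 2 * (f w * g w))"
    using fg by (intro Bochner_Integration.integrable_add integrable_mult_right L2_mult_integrable) (auto simp: L2_def)
  then show ?thesis using fg by (auto simp: L2_def power2_sum mult.assoc)
qed

lemma L2_cmult: "f \<in> L2 \<Longrightarrow> (\<lambda>w. c * f w) \<in> L2"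
  by (auto simp: L2_def power_mult_distrib)

lemma L2_minus: "f \<in> L2 \<Longrightarrow> (\<lambda>w. - f w) \<in> L2"
  using L2_cmult[of f "-1"] by simp

lemma L2_diff: "f \<in> L2 \<Longrightarrow> g \<in> L2 \<Longrightarrow> (\<lambda>w. f w - g w) \<in> L2"
  using L2_add[OF _ L2_minus, of f g] by simp

lemma L2_sum: "(\<And>i. i \<in> I \<Longrightarrow> f i \<in> L2) \<Longrightarrow> (\<lambda>w. \<Sum>i\<in>I. f i w) \<in> L2"
proof (induction I rule: infinite_finite_induct)
  case (insert i I)
  then show ?case using L2_add[of "f i" "\<lambda>w. \<Sum>i\<in>I. f i w"] by simp
qed (auto simp: L2_def)

lemma L2_bounded:
  assumes [measurable]: "f \<in> borel_measurable M" and "AE w in M. \<bar>f w\<bar> \<le> B"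
  shows "f \<in> L2"
proof -
  have "integrable M (\<lambda>w. (f w)\<^sup>2)"
  proof (rule integrable_const_bound[of _ "B\<^sup>2"])
    show "AE w in M. norm ((f w)\<^sup>2) \<le> B\<^sup>2"
      using assms(2) by eventually_elim (auto simp: abs_le_square_iff[symmetric])
  qed auto
  then show ?thesis by (simp add: L2_def)
qed

lemma L2_integrable: "f \<in> L2 \<Longrightarrow> integrable M f"
  using L2_mult_integrable[of f "\<lambda>_. 1"] L2_bounded[of "\<lambda>_. 1" 1] by simp

lemma Yv_measurable [measurable]: "Yv p k \<in> borel_measurable M"
  unfolding Yv_def by measurable

lemma YA_measurable [measurable]: "YA p A \<in> borel_measurable M"
  unfolding YA_def by measurable

text \<open>Outside a null set each factor takes only two values, so the product is essentially
  bounded.\<close>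

lemma YA_L2: "YA p A \<in> L2"
proof (rule L2_bounded)
  show "YA p A \<in> borel_measurable M" by simp
  define b where "b k = \<bar>(1 - p k + qq p k) / (2 * sqrt (p k * qq p k))\<bar> +
    \<bar>(-1 - p k + qq p k) / (2 * sqrt (p k * qq p k))\<bar>" for k
  have "AE w in M. \<forall>k. w k = 1 \<or> w k = -1"
    using AE_coord by (simp add: AE_all_countable)
  then show "AE w in M. \<bar>YA p A w\<bar> \<le> (\<Prod>k\<in>A. b k)"
  proof eventually_elim
    case (elim w)
    have "\<bar>Yv p k w\<bar> \<le> b k" for k
      using elim[rule_format, of k] by (auto simp: Yv_def b_def)
    then show ?case by (auto simp: YA_def abs_prod intro!: prod_mono)
  qed
qed

section \<open>Chaos coefficients and the discrete gradient\<close>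

definition coef :: "((nat \<Rightarrow> real) \<Rightarrow> real) \<Rightarrow> nat set \<Rightarrow> real" where
  "coef f A = (\<integral>w. f w * YA p A w \<partial>M)"

lemma coef_add: "f \<in> L2 \<Longrightarrow> g \<in> L2 \<Longrightarrow> coef (\<lambda>w. f w + g w) A = coef f A + coef g A"
  unfolding coef_def distrib_right
  by (intro Bochner_Integration.integral_add L2_mult_integrable YA_L2)

lemma coef_cmult: "coef (\<lambda>w. c * f w) A = c * coef f A"
  unfolding coef_def mult.assoc by simp

lemma coef_diff: "f \<in> L2 \<Longrightarrow> g \<in> L2 \<Longrightarrow> coef (\<lambda>w. f w - g w) A = coef f A - coef g A"
  unfolding coef_def left_diff_distrib
  by (intro Bochner_Integration.integral_diff L2_mult_integrable YA_L2)

lemma sqrt_pq_pos: "0 < sqrt (p k * qq p k)"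
  using p_pos[of k] p_less_1[of k] by (simp add: qq_def)

lemma Dk_measurable [measurable]: "f \<in> borel_measurable M \<Longrightarrow> Dk p k f \<in> borel_measurable M"
  unfolding Dk_def
  by (intro borel_measurable_times borel_measurable_diff borel_measurable_const measurable_compose[OF upd_measurable])

lemma L2_upd: "f \<in> L2 \<Longrightarrow> s = 1 \<or> s = -1 \<Longrightarrow> (\<lambda>w. f (w(k := s))) \<in> L2"
  using integrable_upd[of "\<lambda>w. (f w)\<^sup>2" s k] by (auto simp: L2_def)

lemma Dk_L2: "f \<in> L2 \<Longrightarrow> Dk p k f \<in> L2"
  unfolding Dk_def by (intro L2_cmult L2_diff L2_upd) auto

lemma Dk_upd [simp]: "Dk p k f (w(k := s)) = Dk p k f w"
  by (simp add: Dk_def)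

lemma YA_upd: "finite A \<Longrightarrow> k \<in> A \<Longrightarrow>
    YA p A (w(k := s)) = (s - p k + qq p k) / (2 * sqrt (p k * qq p k)) * YA p (A - {k}) w"
  by (auto simp: YA_def prod.remove[of A k] Yv_def intro!: prod.cong)

lemma YA_upd_notin: "k \<notin> A \<Longrightarrow> YA p A (w(k := s)) = YA p A w"
  by (auto simp: YA_def Yv_def intro!: prod.cong)

text \<open>The normalisation of \<open>Yv\<close> is chosen for this: averaging against it over
  coordinate \<open>k\<close> weights the two values by plus and minus the same factor, which is the
  one in \<open>Dk\<close>.\<close>

lemma Yv_weights:
  "p k * ((1 - p k + qq p k) / (2 * sqrt (p k * qq p k))) = sqrt (p k * qq p k)"
  "(1 - p k) * ((-1 - p k + qq p k) / (2 * sqrt (p k * qq p k))) = - sqrt (p k * qq p k)"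
proof -
  have 1: "x / (2 * sqrt (p k * qq p k)) = sqrt (p k * qq p k) * (x / (2 * (p k * qq p k)))" for x
    using p_pos[of k] p_less_1[of k] real_sqrt_mult_self[of "p k * qq p k"]
    by (simp add: field_simps qq_def)
  show "p k * ((1 - p k + qq p k) / (2 * sqrt (p k * qq p k))) = sqrt (p k * qq p k)"
    "(1 - p k) * ((-1 - p k + qq p k) / (2 * sqrt (p k * qq p k))) = - sqrt (p k * qq p k)"
    unfolding 1 using p_pos[of k] p_less_1[of k] by (simp_all add: qq_def field_simps)
qed

text \<open>Integrating out coordinate \<open>k\<close> with \<open>Yv_weights\<close> turns the
  factor \<open>Yv p k\<close> into the operator \<open>Dk\<close>. On coefficients the gradient
  therefore acts by deleting an index.\<close>

lemma coef_Dk: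
  assumes f: "f \<in> L2" and A: "finite A" "k \<in> A"
  shows "coef f A = coef (Dk p k f) (A - {k})"
proof -
  let ?Y = "YA p (A - {k})" let ?s = "sqrt (p k * qq p k)"
  have i: "integrable M (\<lambda>w. f (w(k := 1)) * ?Y w)" "integrable M (\<lambda>w. f (w(k := -1)) * ?Y w)"
    by (intro L2_mult_integrable L2_upd f YA_L2; simp)+
  have E: "(\<integral>w. f (w(k := s)) * (c * ?Y w) \<partial>M) = c * (\<integral>w. f (w(k := s)) * ?Y w \<partial>M)" for s c
    unfolding mult.left_commute[of _ c] by simp
  have "coef f A = p k * ((1 - p k + qq p k) / (2 * ?s)) * (\<integral>w. f (w(k := 1)) * ?Y w \<partial>M)
     + (1 - p k) * ((-1 - p k + qq p k) / (2 * ?s)) * (\<integral>w. f (w(k := -1)) * ?Y w \<partial>M)"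
    unfolding coef_def
    by (subst integral_split[OF L2_mult_integrable[OF f YA_L2], where k = k])
       (simp only: YA_upd[OF A] E mult.assoc)
  also have "\<dots> = (\<integral>w. ?s * (f (w(k := 1)) * ?Y w) - ?s * (f (w(k := -1)) * ?Y w) \<partial>M)"
    unfolding Yv_weights using i by simp
  also have "\<dots> = coef (Dk p k f) (A - {k})"
    unfolding coef_def Dk_def by (intro Bochner_Integration.integral_cong) (auto simp: algebra_simps)
  finally show ?thesis .
qed

lemma coef_Dk_notin:
  assumes f: "f \<in> L2" and A: "finite A" "k \<notin> A"
  shows "coef (Dk p k f) A = coef f (insert k A)"
  using coef_Dk[OF f, of "insert k A" k] A by simp

lemma Dk_Dk: "Dk p k (Dk p k f) = (\<lambda>_. 0)"
  by (simp add: Dk_def fun_eq_iff)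

lemma coef_Dk_in: "f \<in> L2 \<Longrightarrow> finite A \<Longrightarrow> k \<in> A \<Longrightarrow> coef (Dk p k f) A = 0"
  by (subst coef_Dk[where k=k]) (auto simp: Dk_L2 Dk_Dk coef_def)

lemma Dk_YA: "finite A \<Longrightarrow> Dk p k (YA p A) = (if k \<in> A then YA p (A - {k}) else (\<lambda>_. 0))"
proof (cases "k \<in> A")
  case True
  assume "finite A"
  then have D: "Dk p k (YA p A) w = sqrt (p k * qq p k) * ((1 - p k + qq p k) / (2 * sqrt (p k * qq p k))
      - (-1 - p k + qq p k) / (2 * sqrt (p k * qq p k))) * YA p (A - {k}) w" for w
    using True by (simp add: Dk_def YA_upd algebra_simps)
  have 1: "sqrt (p k * qq p k) * ((1 - p k + qq p k) / (2 * sqrt (p k * qq p k))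
      - (-1 - p k + qq p k) / (2 * sqrt (p k * qq p k))) = 1"
    unfolding diff_divide_distrib[symmetric] using sqrt_pq_pos[of k] by auto
  show ?thesis using D True unfolding 1 by (simp add: fun_eq_iff)
qed (auto simp: Dk_def fun_eq_iff YA_upd_notin)

text \<open>Orthonormality by induction on \<open>A\<close>: \<open>coef_Dk\<close> removes an
  element from \<open>A\<close> while \<open>Dk_YA\<close> removes it from \<open>B\<close>. The
  base case exchanges the roles of the two sets by symmetry of the inner product.\<close>

lemma coef_YA:
  assumes "finite A" "finite B"
  shows "coef (YA p B) A = (if A = B then 1 else 0)"
  using assms
proof (induction A arbitrary: B rule: finite_induct)
  case empty
  show ?case
  proof (cases "B = {}")
    case True
    then show ?thesis using prob_space by (simp add: coef_def YA_def)
  next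
    case False
    then obtain k where k: "k \<in> B" by auto
    have "coef (YA p B) {} = coef (YA p {}) B"
      by (simp add: coef_def mult.commute)
    also have "\<dots> = 0"
      using k empty by (subst coef_Dk[where k=k]) (auto simp: YA_L2 Dk_YA coef_def)
    finally show ?thesis using False by simp
  qed
next
  case (insert k A)
  have "coef (YA p B) (insert k A) = coef (Dk p k (YA p B)) A"
    using insert by (subst coef_Dk[where k=k]) (auto simp: YA_L2)
  also have "\<dots> = (if insert k A = B then 1 else 0)"
  proof (cases "k \<in> B")
    case True
    have "coef (Dk p k (YA p B)) A = (if A = B - {k} then 1 else 0)"
      using insert.IH[of "B - {k}"] insert.prems True by (simp add: Dk_YA)
    moreover have "A = B - {k} \<longleftrightarrow> insert k A = B"
      using insert.hyps True by auto
    ultimately show ?thesis by simp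
  next
    case False
    then show ?thesis using insert.prems by (auto simp: Dk_YA coef_def)
  qed
  finally show ?case .
qed

end

section \<open>Completeness of the chaos\<close>

context rademacher
begin

text \<open>For a finite family \<open>S\<close> of finite sets this is the squared distance in L2
  from \<open>f\<close> to the span of the \<open>YA p A\<close>. As a quadratic form it can be
  handled without building the Hilbert space.\<close>

definition defect :: "nat set set \<Rightarrow> ((nat \<Rightarrow> real) \<Rightarrow> real) \<Rightarrow> real" where
  "defect S f = (\<integral>w. (f w)\<^sup>2 \<partial>M) - (\<Sum>A\<in>S. (coef f A)\<^sup>2)"

lemma L2_square_integrable: "f \<in> L2 \<Longrightarrow> integrable M (\<lambda>w. (f w)\<^sup>2)"
  by (simp add: L2_def)

lemma coef_sum:
  "(\<And>i. i \<in> I \<Longrightarrow> f i \<in> L2) \<Longrightarrow> coef (\<lambda>w. \<Sum>i\<in>I. f i w) A = (\<Sum>i\<in>I. coef (f i) A)"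
  unfolding coef_def sum_distrib_right
  by (intro Bochner_Integration.integral_sum L2_mult_integrable YA_L2)

lemma integral_square_diff:
  assumes "f \<in> L2" "g \<in> L2"
  shows "(\<integral>w. (f w - g w)\<^sup>2 \<partial>M) = (\<integral>w. (f w)\<^sup>2 \<partial>M) + (\<integral>w. (g w)\<^sup>2 \<partial>M) - 2 * (\<integral>w. f w * g w \<partial>M)"
proof -
  have "(f w - g w)\<^sup>2 = (f w)\<^sup>2 + (g w)\<^sup>2 - 2 * (f w * g w)" for w
    by (simp add: power2_diff)
  then show ?thesis
    using assms by (simp add: L2_square_integrable L2_mult_integrable)
qed

lemma integral_square_add:
  assumes "f \<in> L2" "g \<in> L2"
  shows "(\<integral>w. (f w + g w)\<^sup>2 \<partial>M) = (\<integral>w. (f w)\<^sup>2 \<partial>M) + (\<integral>w. (g w)\<^sup>2 \<partial>M) + 2 * (\<integral>w. f w * g w \<partial>M)"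
proof -
  have "(f w + g w)\<^sup>2 = (f w)\<^sup>2 + (g w)\<^sup>2 + 2 * (f w * g w)" for w
    by (simp add: power2_sum)
  then show ?thesis
    using assms by (simp add: L2_square_integrable L2_mult_integrable)
qed

lemma defect_nonneg:
  assumes f: "f \<in> L2" and S: "finite S" "\<And>A. A \<in> S \<Longrightarrow> finite A"
  shows "0 \<le> defect S f"
proof -
  define P where "P = (\<lambda>w. \<Sum>A\<in>S. coef f A * YA p A w)"
  have P: "P \<in> L2"
    unfolding P_def by (intro L2_sum L2_cmult YA_L2)
  have coefP: "coef P A = coef f A" if "A \<in> S" for A
  proof -
    have "coef P A = (\<Sum>B\<in>S. coef f B * coef (YA p B) A)"
      unfolding P_def by (subst coef_sum) (auto intro: L2_cmult YA_L2 simp: coef_cmult)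
    also have "\<dots> = (\<Sum>B\<in>S. if B = A then coef f A else 0)"
      using that S by (intro sum.cong refl) (auto simp: coef_YA)
    finally show ?thesis using that S by simp
  qed
  have ip: "(\<integral>w. g w * P w \<partial>M) = (\<Sum>A\<in>S. coef f A * coef g A)" if g: "g \<in> L2" for g
  proof -
    have "(\<integral>w. g w * P w \<partial>M) = (\<integral>w. (\<Sum>A\<in>S. coef f A * (g w * YA p A w)) \<partial>M)"
      unfolding P_def sum_distrib_left by (simp add: mult.left_commute)
    also have "\<dots> = (\<Sum>A\<in>S. \<integral>w. coef f A * (g w * YA p A w) \<partial>M)"
      by (intro Bochner_Integration.integral_sum integrable_mult_right L2_mult_integrable g YA_L2)
    finally show ?thesis by (simp add: coef_def)
  qed
  have "0 \<le> (\<integral>w. (f w - P w)\<^sup>2 \<partial>M)" by simp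
  also have "\<dots> = defect S f"
    using ip[OF P] ip[OF f] integral_square_diff[OF f P]
    by (simp add: defect_def coefP power2_eq_square)
  finally show ?thesis .
qed

lemma defect_le: "defect S f \<le> (\<integral>w. (f w)\<^sup>2 \<partial>M)"
  by (simp add: defect_def sum_nonneg)

lemma Bessel:
  assumes "f \<in> L2" "finite S" "\<And>A. A \<in> S \<Longrightarrow> finite A"
  shows "(\<Sum>A\<in>S. (coef f A)\<^sup>2) \<le> (\<integral>w. (f w)\<^sup>2 \<partial>M)"
  using defect_nonneg[OF assms] by (simp add: defect_def)

lemma defect_parallelogram:
  assumes fg: "f \<in> L2" "g \<in> L2"
  shows "defect S (\<lambda>w. f w + g w) + defect S (\<lambda>w. f w - g w) = 2 * defect S f + 2 * defect S g"
proof -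
  have "(\<Sum>A\<in>S. (coef (\<lambda>w. f w + g w) A)\<^sup>2) + (\<Sum>A\<in>S. (coef (\<lambda>w. f w - g w) A)\<^sup>2)
      = 2 * (\<Sum>A\<in>S. (coef f A)\<^sup>2) + 2 * (\<Sum>A\<in>S. (coef g A)\<^sup>2)"
    unfolding sum.distrib[symmetric] sum_distrib_left
    by (intro sum.cong refl) (simp add: fg coef_add coef_diff power2_sum power2_diff)
  then show ?thesis
    using integral_square_add[OF fg] integral_square_diff[OF fg] unfolding defect_def
    by (simp add: algebra_simps)
qed

text \<open>Stands in for the triangle inequality: the defect of the difference is nonnegative and
  is dropped from the parallelogram identity.\<close>

lemma defect_add_le:
  assumes "f \<in> L2" "g \<in> L2" "finite S" "\<And>A. A \<in> S \<Longrightarrow> finite A"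
  shows "defect S (\<lambda>w. f w + g w) \<le> 2 * defect S f + 2 * defect S g"
  using defect_parallelogram[of f g S] defect_nonneg[of "\<lambda>w. f w - g w" S] assms
  by (simp add: L2_diff)

text \<open>The exhaustion by \<open>Pow {..<n}\<close> eventually contains every finite index set;
  a sequence is easier to handle here than the net of finite families, which returns in
  \<open>Parseval\<close>.\<close>

definition expandable :: "((nat \<Rightarrow> real) \<Rightarrow> real) \<Rightarrow> bool" where
  "expandable f \<longleftrightarrow> f \<in> L2 \<and> (\<lambda>n. defect (Pow {..<n}) f) \<longlonglongrightarrow> 0"

lemma finite_Pow_lessThan: "finite (Pow {..<n::nat})" "A \<in> Pow {..<n::nat} \<Longrightarrow> finite A"
  by (auto intro: finite_subset)

lemma expandableI:
  assumes f: "f \<in> L2" and "\<And>e. e > 0 \<Longrightarrow> \<forall>\<^sub>F n in sequentially. defect (Pow {..<n}) f < e"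
  shows "expandable f"
proof -
  have "(\<lambda>n. defect (Pow {..<n}) f) \<longlonglongrightarrow> 0"
  proof (rule order_tendstoI)
    fix a :: real assume "a < 0"
    then show "\<forall>\<^sub>F n in sequentially. a < defect (Pow {..<n}) f"
      using defect_nonneg[OF f finite_Pow_lessThan] by (intro always_eventually allI) (rule less_le_trans)
  qed (use assms in auto)
  then show ?thesis using f by (simp add: expandable_def)
qed

lemma expandable_D: "expandable f \<Longrightarrow> e > 0 \<Longrightarrow> \<forall>\<^sub>F n in sequentially. defect (Pow {..<n}) f < e"
  by (auto simp: expandable_def intro: order_tendstoD)

lemma expandable_add:
  assumes "expandable f" "expandable g"
  shows "expandable (\<lambda>w. f w + g w)"
proof (rule expandableI)
  show "(\<lambda>w. f w + g w) \<in> L2" using assms by (auto simp: expandable_def intro: L2_add)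
  fix e :: real assume "e > 0"
  then have "\<forall>\<^sub>F n in sequentially. defect (Pow {..<n}) f < e / 4 \<and> defect (Pow {..<n}) g < e / 4"
    using assms by (intro eventually_conj expandable_D) auto
  then show "\<forall>\<^sub>F n in sequentially. defect (Pow {..<n}) (\<lambda>w. f w + g w) < e"
  proof eventually_elim
    case (elim n)
    have "defect (Pow {..<n}) (\<lambda>w. f w + g w) \<le> 2 * defect (Pow {..<n}) f + 2 * defect (Pow {..<n}) g"
      using assms by (intro defect_add_le finite_Pow_lessThan) (auto simp: expandable_def)
    then show ?case using elim by simp
  qed
qed

lemma expandable_cmult: "expandable f \<Longrightarrow> expandable (\<lambda>w. c * f w)"
proof -
  assume f: "expandable f"
  have "defect S (\<lambda>w. c * f w) = c\<^sup>2 * defect S f" for S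
    by (simp add: defect_def coef_cmult power_mult_distrib right_diff_distrib sum_distrib_left)
  moreover have "(\<lambda>n. c\<^sup>2 * defect (Pow {..<n}) f) \<longlonglongrightarrow> c\<^sup>2 * 0"
    using f by (intro tendsto_mult_left) (simp add: expandable_def)
  ultimately show ?thesis using f by (simp add: expandable_def L2_cmult)
qed

lemma expandable_0: "expandable (\<lambda>_. 0)"
  by (simp add: expandable_def defect_def coef_def L2_def)

lemma expandable_sum: "(\<And>i. i \<in> I \<Longrightarrow> expandable (f i)) \<Longrightarrow> expandable (\<lambda>w. \<Sum>i\<in>I. f i w)"
proof (induction I rule: infinite_finite_induct)
  case (insert i I)
  then show ?case using expandable_add[of "f i" "\<lambda>w. \<Sum>i\<in>I. f i w"] by simp
qed (auto simp: expandable_0)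

lemma expandable_YA:
  assumes "finite A"
  shows "expandable (YA p A)"
proof -
  obtain m where m: "A \<subseteq> {..<m}"
    using assms finite_nat_iff_bounded by blast
  have norm: "(\<integral>w. (YA p A w)\<^sup>2 \<partial>M) = 1"
    using coef_YA[OF assms assms] by (simp add: coef_def power2_eq_square)
  have "defect (Pow {..<n}) (YA p A) = 0" if "n \<ge> m" for n
  proof -
    have "(\<Sum>B\<in>Pow {..<n}. (coef (YA p A) B)\<^sup>2) = (\<Sum>B\<in>Pow {..<n}. if B = A then 1 else 0)"
      using assms finite_Pow_lessThan by (intro sum.cong refl) (auto simp: coef_YA)
    also have "\<dots> = 1" using m that by (auto simp: finite_Pow_lessThan)
    finally show ?thesis by (simp add: defect_def norm)
  qed
  then have "(\<lambda>n. defect (Pow {..<n}) (YA p A)) \<longlonglongrightarrow> 0"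
    by (intro tendsto_eventually) (auto simp: eventually_at_top_linorder)
  then show ?thesis by (simp add: expandable_def YA_L2)
qed

text \<open>The defect of \<open>f - s i\<close> never exceeds its squared norm, uniformly in the
  family of index sets, so one good approximant \<open>s i\<close> suffices for all large
  \<open>n\<close>.\<close>

lemma expandable_limit:
  assumes f: "f \<in> L2" and s: "\<And>i. expandable (s i)"
    and lim: "(\<lambda>i. \<integral>w. (f w - s i w)\<^sup>2 \<partial>M) \<longlonglongrightarrow> 0"
  shows "expandable f"
proof (rule expandableI[OF f])
  fix e :: real assume e: "e > 0"
  then have "\<forall>\<^sub>F i in sequentially. (\<integral>w. (f w - s i w)\<^sup>2 \<partial>M) < e / 4"
    by (intro order_tendstoD(2)[OF lim]) simp
  then obtain i where i: "(\<integral>w. (f w - s i w)\<^sup>2 \<partial>M) < e / 4"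
    by (auto simp: eventually_at_top_linorder)
  have si: "s i \<in> L2" using s[of i] by (simp add: expandable_def)
  have "\<forall>\<^sub>F n in sequentially. defect (Pow {..<n}) (s i) < e / 4"
    using e by (intro expandable_D s) simp
  then show "\<forall>\<^sub>F n in sequentially. defect (Pow {..<n}) f < e"
  proof eventually_elim
    case (elim n)
    have "defect (Pow {..<n}) (\<lambda>w. s i w + (f w - s i w))
        \<le> 2 * defect (Pow {..<n}) (s i) + 2 * defect (Pow {..<n}) (\<lambda>w. f w - s i w)"
      by (intro defect_add_le finite_Pow_lessThan si L2_diff f)
    then show ?case
      using elim i defect_le[of "Pow {..<n}" "\<lambda>w. f w - s i w"] by simp
  qed
qed

text \<open>Dominated convergence upgrades a pointwise limit to one in L2. In this form the lemma
  serves both countable disjoint unions of sets and simple function approximation.\<close>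

lemma expandable_dominated:
  assumes f: "f \<in> borel_measurable M" and s: "\<And>i. expandable (s i)"
    and lim: "\<And>w. (\<lambda>i. s i w) \<longlonglongrightarrow> f w"
    and g: "g \<in> L2" and bnd: "\<And>i w. \<bar>s i w\<bar> \<le> g w"
  shows "expandable f"
proof (rule expandable_limit[OF _ s])
  have sm: "s i \<in> borel_measurable M" for i
    using s[of i] by (auto simp: expandable_def L2_def)
  have fb: "\<bar>f w\<bar> \<le> g w" for w
    using bnd by (intro tendsto_upperbound[OF tendsto_rabs[OF lim]]) auto
  show fL2: "f \<in> L2"
    unfolding L2_def
  proof safe
    show "integrable M (\<lambda>w. (f w)\<^sup>2)"
    proof (rule Bochner_Integration.integrable_bound[of M "\<lambda>w. (g w)\<^sup>2"])
      show "AE w in M. norm ((f w)\<^sup>2) \<le> norm ((g w)\<^sup>2)"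
        using fb by (auto simp: abs_le_square_iff[symmetric] intro: order.trans[OF _ abs_ge_self])
    qed (use f g in \<open>auto simp: L2_def\<close>)
  qed fact
  have "(\<lambda>i. \<integral>w. (f w - s i w)\<^sup>2 \<partial>M) \<longlonglongrightarrow> (\<integral>w. 0 \<partial>M)"
  proof (rule integral_dominated_convergence[where w="\<lambda>w. 4 * (g w)\<^sup>2"])
    show "integrable M (\<lambda>w. 4 * (g w)\<^sup>2)"
      using g by (auto simp: L2_def)
    show "AE w in M. (\<lambda>i. (f w - s i w)\<^sup>2) \<longlonglongrightarrow> 0"
    proof (rule AE_I2)
      fix w
      have "(\<lambda>i. (f w - s i w)\<^sup>2) \<longlonglongrightarrow> (f w - f w)\<^sup>2"
        by (intro tendsto_intros lim)
      then show "(\<lambda>i. (f w - s i w)\<^sup>2) \<longlonglongrightarrow> 0" by simp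
    qed
    show "AE w in M. norm ((f w - s i w)\<^sup>2) \<le> 4 * (g w)\<^sup>2" for i
    proof (rule AE_I2)
      fix w
      have "\<bar>f w - s i w\<bar> \<le> \<bar>2 * g w\<bar>"
        using fb[of w] bnd[of i w] by linarith
      then have "(f w - s i w)\<^sup>2 \<le> (2 * g w)\<^sup>2" by (simp add: abs_le_square_iff)
      then show "norm ((f w - s i w)\<^sup>2) \<le> 4 * (g w)\<^sup>2" by (simp add: power_mult_distrib)
    qed
  qed (use f sm in auto)
  then show "(\<lambda>i. \<integral>w. (f w - s i w)\<^sup>2 \<partial>M) \<longlonglongrightarrow> 0" by simp
qed

lemma expandable_AE_cong:
  assumes f: "expandable f" and [measurable]: "g \<in> borel_measurable M" and ae: "AE w in M. f w = g w"
  shows "expandable g"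
proof -
  have [measurable]: "f \<in> borel_measurable M" using f by (auto simp: expandable_def L2_def)
  have "coef g A = coef f A" for A
    unfolding coef_def using ae by (intro integral_cong_AE) auto
  moreover have "(\<integral>w. (g w)\<^sup>2 \<partial>M) = (\<integral>w. (f w)\<^sup>2 \<partial>M)"
    using ae by (intro integral_cong_AE) auto
  moreover have "integrable M (\<lambda>w. (g w)\<^sup>2) = integrable M (\<lambda>w. (f w)\<^sup>2)"
    using ae by (intro integrable_cong_AE) auto
  ultimately show ?thesis
    using f by (simp add: expandable_def L2_def defect_def)
qed

text \<open>On the two-point set \<open>{-1, 1}\<close> every function of \<open>\<omega>\<^sub>k\<close> is affine in \<open>Y\<^sub>k\<close>.\<close>

lemma expandable_cylinder:
  assumes J: "finite J"
  shows "expandable (\<lambda>w. \<Prod>j\<in>J. h j (w j))"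
proof -
  define y1 y2 where "y1 j = (1 - p j + qq p j) / (2 * sqrt (p j * qq p j))"
    and "y2 j = (-1 - p j + qq p j) / (2 * sqrt (p j * qq p j))" for j
  define b where "b j = (h j 1 - h j (-1)) / (y1 j - y2 j)" for j
  define a where "a j = h j 1 - b j * y1 j" for j
  have y: "y1 j - y2 j \<noteq> 0" for j
    unfolding y1_def y2_def diff_divide_distrib[symmetric] using sqrt_pq_pos[of j] by auto
  have m: "(\<lambda>w. \<Prod>j\<in>J. h j (w j)) \<in> borel_measurable M"
  proof (rule borel_measurable_prod)
    fix j
    have "(\<lambda>w. w j) \<in> measurable M (measure_pmf (rad_pmf p j))"
      unfolding RadM_def by (rule measurable_component_singleton) simp
    moreover have "h j \<in> measurable (measure_pmf (rad_pmf p j)) borel" by simp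
    ultimately show "(\<lambda>w. h j (w j)) \<in> borel_measurable M" by (rule measurable_compose)
  qed
  have "expandable (\<lambda>w. \<Sum>B\<in>Pow J. (prod b B * prod a (J - B)) * YA p B w)"
    using J by (intro expandable_sum expandable_cmult expandable_YA) (auto intro: finite_subset)
  moreover have "AE w in M. \<forall>k. w k = 1 \<or> w k = -1"
    using AE_coord by (simp add: AE_all_countable)
  then have "AE w in M. (\<Sum>B\<in>Pow J. (prod b B * prod a (J - B)) * YA p B w) = (\<Prod>j\<in>J. h j (w j))"
  proof eventually_elim
    case (elim w)
    have "h j (w j) = b j * Yv p j w + a j" for j
    proof -
      have "h j 1 = b j * y1 j + a j" by (simp add: a_def)
      moreover have "h j (-1) = b j * y2 j + a j"
      proof -
        have "b j * (y1 j - y2 j) = h j 1 - h j (-1)"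
          using y[of j] by (simp add: b_def)
        then show ?thesis by (simp add: a_def algebra_simps)
      qed
      ultimately show ?thesis using elim[rule_format, of j] by (auto simp: Yv_def y1_def y2_def)
    qed
    then have "(\<Prod>j\<in>J. h j (w j)) = (\<Prod>j\<in>J. b j * Yv p j w + a j)" by simp
    also have "\<dots> = (\<Sum>B\<in>Pow J. (\<Prod>j\<in>B. b j * Yv p j w) * prod a (J - B))"
      using J by (rule prod_add)
    finally show ?case by (simp add: prod.distrib YA_def mult_ac)
  qed
  ultimately show ?thesis using m by (intro expandable_AE_cong[where g="\<lambda>w. \<Prod>j\<in>J. h j (w j)"])
qed

text \<open>A Dynkin argument: cylinders are an intersection-stable generator, and sets with
  expandable indicator are closed under complements and disjoint countable unions. Disjointness
  keeps the partial sums of indicators below 1.\<close>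

lemma expandable_indicator:
  assumes "B \<in> sets M"
  shows "expandable (indicator B)"
proof -
  let ?R = "\<lambda>k. measure_pmf (rad_pmf p k)"
  have M_sets: "sets M = sigma_sets UNIV (prod_algebra UNIV ?R)"
    by (simp add: RadM_def sets_PiM PiE_UNIV_domain)
  have B: "B \<in> sigma_sets UNIV (prod_algebra UNIV ?R)"
    using assms M_sets by simp
  have one: "expandable (\<lambda>_. 1)"
    using expandable_YA[of "{}"] by (simp add: YA_def[abs_def])
  show ?thesis
  proof (rule sigma_sets_induct_disjoint[OF Int_stable_prod_algebra _ B, where P="\<lambda>B. expandable (indicator B)"])
    show "prod_algebra UNIV ?R \<subseteq> Pow UNIV" by auto
  next
    fix B assume "B \<in> prod_algebra UNIV ?R"
    then obtain J E where B: "B = prod_emb UNIV ?R J (\<Pi>\<^sub>E j\<in>J. E j)" and J: "finite J"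
      by (elim prod_algebraE) auto
    have "(indicator B w :: real) = (\<Prod>j\<in>J. indicator (E j) (w j))" for w
      using J by (auto simp: B prod_emb_def indicator_def PiE_iff extensional_def)
    then have "(indicator B :: _ \<Rightarrow> real) = (\<lambda>w. \<Prod>j\<in>J. indicator (E j) (w j))" by (simp add: fun_eq_iff)
    then show "expandable (indicator B)"
      using expandable_cylinder[OF J, of "\<lambda>j. indicator (E j)"] by simp
  next
    show "expandable (indicator {})"
      using expandable_0 by (simp add: indicator_def[abs_def])
  next
    fix B assume "expandable (indicator B)"
    then have "expandable (\<lambda>w. 1 + (-1) * indicator B w)"
      by (intro expandable_add one expandable_cmult)
    moreover have "(\<lambda>w. 1 + (-1) * indicator B w :: real) = indicator (UNIV - B)"
      by (auto simp: fun_eq_iff indicator_def)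
    ultimately show "expandable (indicator (UNIV - B))" by simp
  next
    fix C :: "nat \<Rightarrow> (nat \<Rightarrow> real) set"
    assume disj: "disjoint_family C" and C: "range C \<subseteq> sigma_sets UNIV (prod_algebra UNIV ?R)"
      and IH: "\<And>i. expandable (indicator (C i))"
    have [measurable]: "C i \<in> sets M" for i using C M_sets by auto
    show "expandable (indicator (\<Union>i. C i))"
    proof (rule expandable_dominated[where g="\<lambda>_. 1" and s="\<lambda>n w. \<Sum>i<n. indicator (C i) w"])
      have eq: "(\<Sum>i<n. indicator (C i) w) = (indicator (\<Union>i<n. C i) w :: real)" for n w
        using disj by (subst indicator_UN_disjoint) (auto simp: disjoint_family_on_def)
      show "\<bar>\<Sum>i<n. indicator (C i) w\<bar> \<le> (1::real)" for n w
        unfolding eq by (simp add: indicator_def)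
      show "(\<lambda>n. \<Sum>i<n. indicator (C i) w) \<longlonglongrightarrow> (indicator (\<Union>i. C i) w :: real)" for w
        unfolding eq by (rule LIMSEQ_indicator_UN)
      show "expandable (\<lambda>w. \<Sum>i<n. indicator (C i) w)" for n
        by (intro expandable_sum IH)
    qed (use one in \<open>auto simp: expandable_def\<close>)
  qed
qed

text \<open>The approximating simple functions are bounded by \<open>2 * \<bar>f w\<bar>\<close>, a
  square integrable majorant, which covers unbounded \<open>f\<close> as well.\<close>

lemma L2_expandable:
  assumes f: "f \<in> L2"
  shows "expandable f"
proof -
  have fm: "f \<in> borel_measurable M" using f by (simp add: L2_def)
  obtain s where s: "\<And>i. simple_function M (s i)" "\<And>w. (\<lambda>i. s i w) \<longlonglongrightarrow> f w"
      "\<And>i w. dist (s i w) 0 \<le> 2 * dist (f w) 0"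
    using borel_measurable_implies_sequence_metric[OF fm, of 0] by auto
  show ?thesis
  proof (rule expandable_dominated[OF fm _ s(2)])
    show "expandable (s i)" for i
    proof -
      have "expandable (\<lambda>w. \<Sum>y\<in>s i ` space M. y * indicator (s i -` {y} \<inter> space M) w)"
        using s(1)[of i] by (intro expandable_sum expandable_cmult expandable_indicator) (auto dest: simple_functionD)
      moreover have eq: "s i = (\<lambda>w. \<Sum>y\<in>s i ` space M. y * indicator (s i -` {y} \<inter> space M) w)"
      proof
        show "s i w = (\<Sum>y\<in>s i ` space M. y * indicator (s i -` {y} \<inter> space M) w)" for w
          by (rule trans[OF simple_function_indicator_representation_banach[OF s(1)]]) (simp_all add: mult.commute)
      qed
      then have "expandable (s i) = expandable (\<lambda>w. \<Sum>y\<in>s i ` space M. y * indicator (s i -` {y} \<inter> space M) w)"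
        by (rule arg_cong)
      ultimately show ?thesis by blast
    qed
    show "(\<lambda>w. 2 * \<bar>f w\<bar>) \<in> L2"
      using f by (auto simp: L2_def power_mult_distrib)
    show "\<bar>s i w\<bar> \<le> 2 * \<bar>f w\<bar>" for i w
      using s(3)[of i w] by simp
  qed
qed

section \<open>Parseval's identity\<close>

lemma Parseval_square: "f \<in> L2 \<Longrightarrow> (\<lambda>n. \<Sum>A\<in>Pow {..<n}. (coef f A)\<^sup>2) \<longlonglongrightarrow> (\<integral>w. (f w)\<^sup>2 \<partial>M)"
proof -
  assume "f \<in> L2"
  then have "(\<lambda>n. defect (Pow {..<n}) f) \<longlonglongrightarrow> 0"
    using L2_expandable by (simp add: expandable_def)
  then have "(\<lambda>n. (\<integral>w. (f w)\<^sup>2 \<partial>M) - defect (Pow {..<n}) f) \<longlonglongrightarrow> (\<integral>w. (f w)\<^sup>2 \<partial>M) - 0"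
    by (intro tendsto_intros)
  then show ?thesis by (simp add: defect_def)
qed

text \<open>Polarisation of \<open>Parseval_square\<close>.\<close>

lemma Parseval_limit:
  assumes f: "f \<in> L2" and g: "g \<in> L2"
  shows "(\<lambda>n. \<Sum>A\<in>Pow {..<n}. coef f A * coef g A) \<longlonglongrightarrow> (\<integral>w. f w * g w \<partial>M)"
proof -
  have "(\<lambda>n. ((\<Sum>A\<in>Pow {..<n}. (coef (\<lambda>w. f w + g w) A)\<^sup>2)
      - (\<Sum>A\<in>Pow {..<n}. (coef (\<lambda>w. f w - g w) A)\<^sup>2)) / 4)
    \<longlonglongrightarrow> ((\<integral>w. (f w + g w)\<^sup>2 \<partial>M) - (\<integral>w. (f w - g w)\<^sup>2 \<partial>M)) / 4"
    by (intro tendsto_intros Parseval_square L2_add L2_diff f g) simp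
  moreover have "((\<integral>w. (f w + g w)\<^sup>2 \<partial>M) - (\<integral>w. (f w - g w)\<^sup>2 \<partial>M)) / 4 = (\<integral>w. f w * g w \<partial>M)"
    using f g by (simp add: integral_square_add integral_square_diff)
  moreover have "((\<Sum>A\<in>S. (coef (\<lambda>w. f w + g w) A)\<^sup>2)
      - (\<Sum>A\<in>S. (coef (\<lambda>w. f w - g w) A)\<^sup>2)) / 4 = (\<Sum>A\<in>S. coef f A * coef g A)" for S
    unfolding sum_subtractf[symmetric] sum_divide_distrib
    by (intro sum.cong refl) (simp add: coef_add coef_diff f g power2_sum power2_diff)
  ultimately show ?thesis by simp
qed

lemma coef_square_summable:
  assumes f: "f \<in> L2"
  shows "(\<lambda>A. (coef f A)\<^sup>2) summable_on {A. finite A}"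
  using Bessel[OF f] by (intro nonneg_bdd_above_summable_on) (auto intro!: bdd_aboveI)

lemma coef_mult_abs_summable:
  assumes f: "f \<in> L2" and g: "g \<in> L2"
  shows "(\<lambda>A. norm (coef f A * coef g A)) summable_on {A. finite A}"
proof (rule Infinite_Sum.abs_summable_product)
  show "(\<lambda>A. norm (coef f A * coef f A)) summable_on {A. finite A}"
    "(\<lambda>A. norm (coef g A * coef g A)) summable_on {A. finite A}"
    using coef_square_summable[OF f] coef_square_summable[OF g] by (simp_all add: power2_eq_square)
qed

lemma filterlim_Pow_lessThan:
  "filterlim (\<lambda>n. Pow {..<n}) (finite_subsets_at_top {A::nat set. finite A}) sequentially"
  unfolding filterlim_finite_subsets_at_top
proof safe
  fix X :: "nat set set" assume X: "finite X" "X \<subseteq> {A. finite A}"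
  then have "finite (\<Union>X)" by auto
  then obtain m where m: "\<Union>X \<subseteq> {..<m}"
    using finite_nat_iff_bounded by blast
  show "\<forall>\<^sub>F n in sequentially. finite (Pow {..<n}) \<and> X \<subseteq> Pow {..<n} \<and> Pow {..<n} \<subseteq> {A. finite A}"
  proof (rule eventually_sequentiallyI[of m], intro conjI)
    fix n assume "m \<le> n"
    show "X \<subseteq> Pow {..<n}"
    proof
      fix A assume "A \<in> X"
      then have "A \<subseteq> {..<m}" using m by auto
      then show "A \<in> Pow {..<n}" using \<open>m \<le> n\<close> by auto
    qed
  qed (auto intro: finite_subset)
qed

text \<open>Absolute summability turns the limit along \<open>Pow {..<n}\<close> into an unordered
  sum. This form allows the reindexing and the interchange of sums over \<open>A\<close> and over
  \<open>k \<in> A\<close> needed for gradients.\<close>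

lemma Parseval:
  assumes f: "f \<in> L2" and g: "g \<in> L2"
  shows "((\<lambda>A. coef f A * coef g A) has_sum (\<integral>w. f w * g w \<partial>M)) {A. finite A}"
proof -
  have sm: "(\<lambda>A. coef f A * coef g A) summable_on {A. finite A}"
    by (rule Infinite_Sum.abs_summable_summable[OF coef_mult_abs_summable[OF f g]])
  have "(\<lambda>n. \<Sum>A\<in>Pow {..<n}. coef f A * coef g A) \<longlonglongrightarrow> infsum (\<lambda>A. coef f A * coef g A) {A. finite A}"
    using has_sum_infsum[OF sm] filterlim_Pow_lessThan unfolding has_sum_def
    by (rule filterlim_compose)
  then have "infsum (\<lambda>A. coef f A * coef g A) {A. finite A} = (\<integral>w. f w * g w \<partial>M)"
    using Parseval_limit[OF f g] LIMSEQ_unique by blast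
  then show ?thesis using has_sum_infsum[OF sm] by (rule subst)
qed

end

section \<open>Integration by parts and the approximate Stein identity\<close>

context rademacher
begin

text \<open>Parseval for the two gradients: coefficients at sets containing \<open>k\<close> vanish,
  and the others are moved to \<open>insert k A\<close>.\<close>

lemma Parseval_Dk:
  assumes f: "f \<in> L2" and g: "g \<in> L2"
  shows "((\<lambda>A. coef f A * coef g A) has_sum (\<integral>w. Dk p k f w * Dk p k g w \<partial>M)) {A. finite A \<and> k \<in> A}"
proof -
  let ?c = "\<lambda>A. coef f A * coef g A"
  have "((\<lambda>A. coef (Dk p k f) A * coef (Dk p k g) A) has_sum (\<integral>w. Dk p k f w * Dk p k g w \<partial>M)) {A. finite A}"
    by (intro Parseval Dk_L2 f g)
  also have "?this \<longleftrightarrow> ((?c \<circ> insert k) has_sum (\<integral>w. Dk p k f w * Dk p k g w \<partial>M)) {A. finite A \<and> k \<notin> A}"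
    by (intro has_sum_cong_neutral) (auto simp: coef_Dk_in coef_Dk_notin f g)
  also have "\<dots> \<longleftrightarrow> (?c has_sum (\<integral>w. Dk p k f w * Dk p k g w \<partial>M)) (insert k ` {A. finite A \<and> k \<notin> A})"
    by (intro has_sum_reindex[symmetric]) (auto simp: inj_on_def)
  also have "insert k ` {A. finite A \<and> k \<notin> A} = {A. finite A \<and> k \<in> A}"
  proof safe
    fix A assume "finite A" "k \<in> A"
    then show "A \<in> insert k ` {A. finite A \<and> k \<notin> A}"
      by (intro image_eqI[of _ _ "A - {k}"]) auto
  qed
  finally show ?thesis .
qed

text \<open>A double count over pairs \<open>k \<in> A\<close>: summing over \<open>k\<close> counts
  each \<open>A\<close> once per element, whence the weight \<open>card A\<close>, the eigenvalue of
  -L. The summability assumption justifies the interchange.\<close>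

lemma gradient_inner_has_sum:
  assumes f: "f \<in> L2" and g: "g \<in> L2"
    and sm: "(\<lambda>A. real (card A) * \<bar>coef f A * coef g A\<bar>) summable_on {A. finite A}"
  shows "((\<lambda>k. \<integral>w. Dk p k f w * Dk p k g w \<partial>M) has_sum
    (\<Sum>\<^sub>\<infinity>A\<in>{A. finite A}. real (card A) * (coef f A * coef g A))) UNIV"
proof -
  define c where "c = (\<lambda>A. coef f A * coef g A)"
  let ?T = "Sigma {A. finite A} (\<lambda>A::nat set. A)"
  have inner: "infsum (\<lambda>k. norm (c A)) A = real (card A) * \<bar>c A\<bar>" if "finite A" for A :: "nat set"
    using that by (simp add: infsum_finite)
  have "(\<lambda>x. norm (c (fst x))) summable_on ?T"
    by (subst Infinite_Sum.abs_summable_on_Sigma_iff)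
      (use sm in \<open>auto simp: summable_on_finite inner c_def cong: summable_on_cong\<close>)
  then have "(\<lambda>x. c (fst x)) summable_on ?T"
    by (rule Infinite_Sum.abs_summable_summable)
  then obtain S where S: "((\<lambda>x. c (fst x)) has_sum S) ?T"
    by (auto simp: summable_on_def)
  have "((\<lambda>A. real (card A) * c A) has_sum S) {A. finite A}"
    by (rule has_sum_SigmaD[OF S]) (auto intro!: has_sum_finiteI)
  then have S_eq: "(\<Sum>\<^sub>\<infinity>A\<in>{A. finite A}. real (card A) * c A) = S"
    by (rule infsumI)
  have "((\<lambda>x. c (snd x)) has_sum S) (prod.swap ` ?T)"
    by (subst has_sum_reindex) (use S in \<open>auto simp: o_def\<close>)
  also have "prod.swap ` ?T = Sigma UNIV (\<lambda>k. {A. finite A \<and> k \<in> A})"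
    by (auto simp: image_iff)
  finally have "((\<lambda>k. \<integral>w. Dk p k f w * Dk p k g w \<partial>M) has_sum S) UNIV"
    by (rule has_sum_SigmaD) (use Parseval_Dk[OF f g] in \<open>auto simp: c_def\<close>)
  then show ?thesis using S_eq by (simp add: c_def)
qed

definition L2_seq :: "(nat \<Rightarrow> (nat \<Rightarrow> real) \<Rightarrow> real) \<Rightarrow> bool" where
  "L2_seq u \<longleftrightarrow> (\<forall>k. u k \<in> borel_measurable M) \<and> (\<integral>\<^sup>+w. (\<Sum>k. ennreal ((u k w)\<^sup>2)) \<partial>M) < \<infinity>"

lemma D12_iff: "f \<in> D12 p \<longleftrightarrow> f \<in> L2 \<and> L2_seq (\<lambda>k. Dk p k f)"
  by (auto simp: D12_def L2_def L2_seq_def)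

text \<open>All three conclusions follow from |ab| <= a^2 + b^2 and Tonelli; together they are what
  termwise integration of the inner product asks for.\<close>

lemma L2_seq_mult:
  assumes u: "L2_seq u" and v: "L2_seq v"
  shows "integrable M (\<lambda>w. u k w * v k w)"
    and "AE w in M. summable (\<lambda>k. norm (u k w * v k w))"
    and "summable (\<lambda>k. \<integral>w. norm (u k w * v k w) \<partial>M)"
proof -
  have [measurable]: "u k \<in> borel_measurable M" "v k \<in> borel_measurable M" for k
    using u v by (auto simp: L2_seq_def)
  have "\<bar>a * b\<bar> \<le> a\<^sup>2 + b\<^sup>2" for a b :: real
  proof -
    have "2 * \<bar>a\<bar> * \<bar>b\<bar> \<le> a\<^sup>2 + b\<^sup>2" "0 \<le> \<bar>a\<bar> * \<bar>b\<bar>"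
      using sum_squares_bound[of "\<bar>a\<bar>" "\<bar>b\<bar>"] by auto
    then show ?thesis unfolding abs_mult by linarith
  qed
  then have "(\<integral>\<^sup>+w. (\<Sum>k. ennreal (norm (u k w * v k w))) \<partial>M)
      \<le> (\<integral>\<^sup>+w. (\<Sum>k. ennreal ((u k w)\<^sup>2) + ennreal ((v k w)\<^sup>2)) \<partial>M)"
    by (intro nn_integral_mono suminf_le) (auto simp: ennreal_plus[symmetric] simp del: ennreal_plus intro!: ennreal_leI)
  also have "\<dots> = (\<integral>\<^sup>+w. (\<Sum>k. ennreal ((u k w)\<^sup>2)) + (\<Sum>k. ennreal ((v k w)\<^sup>2)) \<partial>M)"
    by (subst suminf_add) auto
  also have "\<dots> < \<infinity>"
    using u v by (subst nn_integral_add) (auto simp: L2_seq_def)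
  finally have fin: "(\<integral>\<^sup>+w. (\<Sum>k. ennreal (norm (u k w * v k w))) \<partial>M) < \<infinity>" .
  then have "AE w in M. (\<Sum>k. ennreal (norm (u k w * v k w))) \<noteq> \<infinity>"
    by (intro nn_integral_PInf_AE) auto
  then show "AE w in M. summable (\<lambda>k. norm (u k w * v k w))"
    by eventually_elim (auto intro!: summable_suminf_not_top)
  have sum_fin: "(\<Sum>k. \<integral>\<^sup>+w. ennreal (norm (u k w * v k w)) \<partial>M) < \<infinity>"
    using fin by (subst nn_integral_suminf[symmetric]) auto
  have "(\<integral>\<^sup>+w. ennreal (norm (u k w * v k w)) \<partial>M) < \<infinity>" for k
    using ennreal_suminf_lessD[OF sum_fin] by simp
  then show int: "integrable M (\<lambda>w. u k w * v k w)" for k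
    by (intro integrableI_bounded) auto
  have "(\<Sum>k. ennreal (\<integral>w. norm (u k w * v k w) \<partial>M)) \<noteq> top"
    using sum_fin int by (subst nn_integral_eq_integral[symmetric]) (auto simp: less_top)
  then show "summable (\<lambda>k. \<integral>w. norm (u k w * v k w) \<partial>M)"
    by (intro summable_suminf_not_top) auto
qed

lemma L2_seq_inner_integrable:
  assumes "L2_seq u" "L2_seq v"
  shows "integrable M (\<lambda>w. \<Sum>k. u k w * v k w)"
  using L2_seq_mult[OF assms] by (intro integrable_suminf)

lemma L2_seq_inner_integral:
  assumes "L2_seq u" "L2_seq v"
  shows "(\<integral>w. (\<Sum>k. u k w * v k w) \<partial>M) = (\<Sum>k. \<integral>w. u k w * v k w \<partial>M)"
  using L2_seq_mult[OF assms] by (intro integral_suminf)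

lemma L2_seq_uminus: "L2_seq u \<Longrightarrow> L2_seq (\<lambda>k w. - u k w)"
  by (auto simp: L2_seq_def)

text \<open>Stated with the factor \<open>card A\<close> on the left, since the weight produced by
  \<open>gradient_inner_has_sum\<close> is to cancel the factor 1/n of L^{-1}.\<close>

lemma coef_Linv:
  assumes "is_Linv p F G" "finite A"
  shows "real (card A) * coef G A = (if A = {} then 0 else - coef F A)"
  using assms card_0_eq[OF assms(2)] by (simp add: is_Linv_def coef_def)

text \<open>L^{-1} gains regularity: for nonempty \<open>A\<close>, \<open>card A\<close> times the
  squared coefficient of \<open>G\<close> is at most \<open>(card A * coef G A)\<^sup>2\<close>,
  which is the squared coefficient of \<open>F\<close>.\<close>

lemma Linv_D12:
  assumes F: "F \<in> L2" and G: "is_Linv p F G"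
  shows "G \<in> D12 p"
proof -
  have GL2: "G \<in> L2" using G by (auto simp: is_Linv_def L2_def)
  have "(\<lambda>A. real (card A) * \<bar>coef G A * coef G A\<bar>) summable_on {A. finite A}"
  proof (rule summable_on_comparison_test[OF coef_square_summable[OF F]])
    fix A :: "nat set" assume "A \<in> {A. finite A}"
    then have A: "finite A" by simp
    show "real (card A) * \<bar>coef G A * coef G A\<bar> \<le> (coef F A)\<^sup>2"
    proof (cases "A = {}")
      case False
      then have c: "1 \<le> real (card A)" using A by (simp add: Suc_le_eq card_gt_0_iff)
      have "real (card A) * \<bar>coef G A * coef G A\<bar> = real (card A) * (coef G A)\<^sup>2"
        by (simp add: power2_eq_square)
      also have "\<dots> \<le> real (card A) * (real (card A) * (coef G A)\<^sup>2)"
        using c mult_right_mono[OF c, of "(coef G A)\<^sup>2"] by (intro mult_left_mono) auto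
      also have "\<dots> = (real (card A) * coef G A)\<^sup>2" by (simp add: power2_eq_square)
      also have "\<dots> = (coef F A)\<^sup>2" using coef_Linv[OF G A] False by simp
      finally show ?thesis .
    qed simp
  qed auto
  from gradient_inner_has_sum[OF GL2 GL2 this]
  have "(\<lambda>k. \<integral>w. Dk p k G w * Dk p k G w \<partial>M) sums
      (\<Sum>\<^sub>\<infinity>A\<in>{A. finite A}. real (card A) * (coef G A * coef G A))"
    by (rule has_sum_imp_sums)
  then have sm: "summable (\<lambda>k. \<integral>w. (Dk p k G w)\<^sup>2 \<partial>M)"
    by (simp add: sums_iff power2_eq_square)
  have m[measurable]: "Dk p k G \<in> borel_measurable M" for k
    using GL2 by (intro Dk_measurable) (simp add: L2_def)
  have "(\<integral>\<^sup>+w. (\<Sum>k. ennreal ((Dk p k G w)\<^sup>2)) \<partial>M) = (\<Sum>k. \<integral>\<^sup>+w. ennreal ((Dk p k G w)\<^sup>2) \<partial>M)"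
    by (intro nn_integral_suminf) auto
  also have "\<dots> = (\<Sum>k. ennreal (\<integral>w. (Dk p k G w)\<^sup>2 \<partial>M))"
  proof (rule suminf_cong)
    show "(\<integral>\<^sup>+w. ennreal ((Dk p k G w)\<^sup>2) \<partial>M) = ennreal (\<integral>w. (Dk p k G w)\<^sup>2 \<partial>M)" for k
      using L2_square_integrable[OF Dk_L2[OF GL2]] by (rule nn_integral_eq_integral) simp
  qed
  also have "\<dots> = ennreal (\<Sum>k. \<integral>w. (Dk p k G w)\<^sup>2 \<partial>M)"
    by (intro suminf_ennreal2 sm) auto
  finally have "(\<integral>\<^sup>+w. (\<Sum>k. ennreal ((Dk p k G w)\<^sup>2)) \<partial>M) < \<infinity>"
    by (metis ennreal_less_top infinity_ennreal_def)
  then show ?thesis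
    unfolding D12_iff L2_seq_def by (intro conjI allI GL2 m)
qed

text \<open>On coefficients, the weight \<open>card A\<close> from the gradients cancels the factor
  1/n in L^{-1}, leaving Parseval for \<open>F\<close> and \<open>h\<close>. The empty set
  contributes nothing because \<open>F\<close> is centred.\<close>

lemma integration_by_parts:
  assumes F: "F \<in> L2" and mean0: "(\<integral>w. F w \<partial>M) = 0" and G: "is_Linv p F G" and h: "h \<in> D12 p"
  shows "(\<integral>w. (\<Sum>k. Dk p k h w * - Dk p k G w) \<partial>M) = (\<integral>w. F w * h w \<partial>M)"
proof -
  have GD: "G \<in> D12 p" by (rule Linv_D12[OF F G])
  have hL: "h \<in> L2" and GL: "G \<in> L2" using h GD by (auto simp: D12_iff)
  have F0: "coef F {} = 0" using mean0 by (simp add: coef_def YA_def)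
  have eq: "real (card A) * (coef h A * coef G A) = - (coef F A * coef h A)" if "finite A" for A
    using coef_Linv[OF G that] F0 by (cases "A = {}") (auto simp: mult.left_commute[of "real _"])
  have "(\<lambda>A. real (card A) * \<bar>coef h A * coef G A\<bar>) summable_on {A. finite A}"
  proof (subst summable_on_cong)
    show "real (card A) * \<bar>coef h A * coef G A\<bar> = norm (coef F A * coef h A)" if "A \<in> {A. finite A}" for A
      using arg_cong[OF eq[of A], of abs] that by (simp add: abs_mult)
  qed (rule coef_mult_abs_summable[OF F hL])
  from gradient_inner_has_sum[OF hL GL this]
  have s: "(\<lambda>k. \<integral>w. Dk p k h w * Dk p k G w \<partial>M) sums
      (\<Sum>\<^sub>\<infinity>A\<in>{A. finite A}. real (card A) * (coef h A * coef G A))"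
    by (rule has_sum_imp_sums)
  have "(\<Sum>\<^sub>\<infinity>A\<in>{A. finite A}. real (card A) * (coef h A * coef G A))
      = (\<Sum>\<^sub>\<infinity>A\<in>{A. finite A}. - (coef F A * coef h A))"
    by (intro infsum_cong) (simp add: eq)
  also have "\<dots> = - (\<integral>w. F w * h w \<partial>M)"
    using Parseval[OF F hL] by (simp add: infsum_uminus infsumI)
  finally have "(\<Sum>k. \<integral>w. Dk p k h w * Dk p k G w \<partial>M) = - (\<integral>w. F w * h w \<partial>M)"
    using s by (simp add: sums_iff)
  moreover have "(\<integral>w. (\<Sum>k. Dk p k h w * - Dk p k G w) \<partial>M) = (\<Sum>k. \<integral>w. Dk p k h w * - Dk p k G w \<partial>M)"
    using h GD by (intro L2_seq_inner_integral L2_seq_uminus) (auto simp: D12_iff)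
  moreover have "(\<Sum>k. \<integral>w. Dk p k h w * - Dk p k G w \<partial>M) = - (\<Sum>k. \<integral>w. Dk p k h w * Dk p k G w \<partial>M)"
    using s by (simp add: suminf_minus sums_iff)
  ultimately show ?thesis by simp
qed

text \<open>\<open>Dk\<close> compares \<phi> at two points only, so a global Lipschitz bound
  controls the gradient directly and kinks are harmless.\<close>

lemma D12_lipschitz:
  assumes f: "f \<in> D12 p" and m: "\<phi> \<in> borel_measurable borel"
    and lip: "\<And>x y. \<bar>\<phi> x - \<phi> y\<bar> \<le> B * \<bar>x - y\<bar>"
  shows "(\<lambda>w. \<phi> (f w)) \<in> D12 p"
proof -
  have fL: "f \<in> L2" and fD: "L2_seq (\<lambda>k. Dk p k f)" using f by (auto simp: D12_iff)
  have fm: "f \<in> borel_measurable M" using fL by (simp add: L2_def)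
  have pm: "(\<lambda>w. \<phi> (f w)) \<in> borel_measurable M" using measurable_compose[OF fm m] .
  have B: "0 \<le> B" using lip[of 1 0] by (auto intro: order.trans[OF abs_ge_zero])
  have "(\<lambda>w. \<phi> (f w)) \<in> L2"
    unfolding L2_def
  proof safe
    show "integrable M (\<lambda>w. (\<phi> (f w))\<^sup>2)"
    proof (rule Bochner_Integration.integrable_bound[of M "\<lambda>w. 2 * (\<phi> 0)\<^sup>2 + 2 * (B\<^sup>2 * (f w)\<^sup>2)"])
      show "integrable M (\<lambda>w. 2 * (\<phi> 0)\<^sup>2 + 2 * (B\<^sup>2 * (f w)\<^sup>2))"
        using fL by (auto simp: L2_def)
      have "(\<phi> x)\<^sup>2 \<le> 2 * (\<phi> 0)\<^sup>2 + 2 * (B\<^sup>2 * x\<^sup>2)" for x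
      proof -
        have "(\<phi> x - \<phi> 0)\<^sup>2 \<le> (B * x)\<^sup>2"
          using lip[of x 0] B by (simp add: abs_le_square_iff[symmetric] abs_mult)
        moreover have "(\<phi> x)\<^sup>2 \<le> 2 * (\<phi> 0)\<^sup>2 + 2 * (\<phi> x - \<phi> 0)\<^sup>2"
          using zero_le_power2[of "\<phi> x - 2 * \<phi> 0"] by (simp add: power2_eq_square algebra_simps)
        ultimately show ?thesis by (simp add: power_mult_distrib)
      qed
      then show "AE w in M. norm ((\<phi> (f w))\<^sup>2) \<le> norm (2 * (\<phi> 0)\<^sup>2 + 2 * (B\<^sup>2 * (f w)\<^sup>2))"
        by simp
    qed (use pm in simp)
  qed fact
  moreover have "L2_seq (\<lambda>k. Dk p k (\<lambda>w. \<phi> (f w)))"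
    unfolding L2_seq_def
  proof
    show "\<forall>k. Dk p k (\<lambda>w. \<phi> (f w)) \<in> borel_measurable M"
      using pm Dk_measurable by blast
    have [measurable]: "Dk p k f \<in> borel_measurable M" for k using fm by (rule Dk_measurable)
    have le: "(Dk p k (\<lambda>w. \<phi> (f w)) w)\<^sup>2 \<le> B\<^sup>2 * (Dk p k f w)\<^sup>2" for k w
    proof -
      have "\<bar>Dk p k (\<lambda>w. \<phi> (f w)) w\<bar> \<le> \<bar>B * Dk p k f w\<bar>"
        using sqrt_pq_pos[of k] B lip[of "f (w(k := 1))" "f (w(k := -1))"]
        by (simp add: Dk_def abs_mult mult.left_commute[of B])
      then show ?thesis by (simp add: abs_le_square_iff power_mult_distrib)
    qed
    have "(\<integral>\<^sup>+w. (\<Sum>k. ennreal ((Dk p k (\<lambda>w. \<phi> (f w)) w)\<^sup>2)) \<partial>M)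
        \<le> (\<integral>\<^sup>+w. (\<Sum>k. ennreal (B\<^sup>2) * ennreal ((Dk p k f w)\<^sup>2)) \<partial>M)"
      using le by (intro nn_integral_mono suminf_le) (auto simp: ennreal_mult[symmetric] intro!: ennreal_leI)
    also have "\<dots> = ennreal (B\<^sup>2) * (\<integral>\<^sup>+w. (\<Sum>k. ennreal ((Dk p k f w)\<^sup>2)) \<partial>M)"
      by (simp add: nn_integral_cmult)
    also have "\<dots> < \<infinity>"
      using fD by (simp add: L2_seq_def ennreal_mult_less_top)
    finally show "(\<integral>\<^sup>+w. (\<Sum>k. ennreal ((Dk p k (\<lambda>w. \<phi> (f w)) w)\<^sup>2)) \<partial>M) < \<infinity>" .
  qed
  ultimately show ?thesis by (simp add: D12_iff)
qed

lemma Dk_chain_remainder: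
  assumes w: "w k = 1 \<or> w k = -1" and H: "mono H"
    and rem: "\<And>x y. \<bar>\<phi> y - \<phi> x - \<psi> x * (y - x)\<bar> \<le> \<bar>y - x\<bar> * \<bar>H y - H x\<bar>"
  shows "\<bar>Dk p k (\<lambda>w. \<phi> (F w)) w - \<psi> (F w) * Dk p k F w\<bar>
    \<le> (1 / sqrt (p k * qq p k)) * Dk p k F w * Dk p k (\<lambda>w. H (F w)) w"
proof -
  define s a b where "s = sqrt (p k * qq p k)" and "a = F (w(k := 1))" and "b = F (w(k := -1))"
  have s: "s > 0" using sqrt_pq_pos by (simp add: s_def)
  have F: "F w = a \<or> F w = b"
    using w fun_upd_triv[of w k] unfolding a_def b_def by metis
  \<comment> \<open>Monotonicity of \<open>H\<close> gives the two differences the same sign. Hence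
    the final bound can be written with \<open>Dk\<close> of \<open>H(F)\<close> itself, as the
    duality with \<open>V\<close> requires.\<close>
  have sgn: "(a - b) * (H a - H b) = \<bar>a - b\<bar> * \<bar>H a - H b\<bar>"
    using monoD[OF H, of a b] monoD[OF H, of b a] by (cases "a \<le> b") (auto simp: abs_if algebra_simps)
  have "\<bar>(\<phi> a - \<phi> b) - \<psi> (F w) * (a - b)\<bar> \<le> \<bar>a - b\<bar> * \<bar>H a - H b\<bar>"
    using F
  proof
    assume "F w = a"
    moreover have "\<bar>(\<phi> a - \<phi> b) - \<psi> a * (a - b)\<bar> = \<bar>\<phi> b - \<phi> a - \<psi> a * (b - a)\<bar>"
      by (subst abs_minus_cancel[symmetric]) (simp add: algebra_simps)
    ultimately show ?thesis
      using rem[of b a] by (simp add: abs_minus_commute[of a b] abs_minus_commute[of "H a" "H b"])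
  next
    assume "F w = b"
    then show ?thesis using rem[of a b] by simp
  qed
  then have "s * \<bar>(\<phi> a - \<phi> b) - \<psi> (F w) * (a - b)\<bar> \<le> s * ((a - b) * (H a - H b))"
    using s by (simp add: sgn)
  moreover have "\<bar>Dk p k (\<lambda>w. \<phi> (F w)) w - \<psi> (F w) * Dk p k F w\<bar> = s * \<bar>(\<phi> a - \<phi> b) - \<psi> (F w) * (a - b)\<bar>"
  proof -
    have "Dk p k (\<lambda>w. \<phi> (F w)) w - \<psi> (F w) * Dk p k F w = s * ((\<phi> a - \<phi> b) - \<psi> (F w) * (a - b))"
      by (simp add: Dk_def s_def a_def b_def algebra_simps)
    then show ?thesis using s by (simp add: abs_mult)
  qed
  moreover have "(1 / sqrt (p k * qq p k)) * Dk p k F w * Dk p k (\<lambda>w. H (F w)) w = s * ((a - b) * (H a - H b))"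
    using s by (simp add: Dk_def s_def[symmetric] a_def[symmetric] b_def[symmetric])
  ultimately show ?thesis by simp
qed

text \<open>\<phi> and \<psi> are linked only through \<open>rem\<close>, not by differentiability,
  so a kink of \<phi> and a jump of \<open>H\<close> are both admissible. The bound on \<psi> keeps
  its product with the gradient pairing integrable.\<close>

lemma approximate_Stein_identity:
  assumes F: "F \<in> D12 p" and mean0: "(\<integral>w. F w \<partial>M) = 0" and G: "is_Linv p F G"
    and V: "is_delta p (\<lambda>k w. (1 / sqrt (p k * qq p k)) * Dk p k F w * \<bar>Dk p k G w\<bar>) V"
    and \<phi>: "(\<lambda>w. \<phi> (F w)) \<in> D12 p" and HF: "(\<lambda>w. H (F w)) \<in> D12 p"
    and \<psi>: "\<psi> \<in> borel_measurable borel" "\<And>x. \<bar>\<psi> x\<bar> \<le> B"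
    and H: "mono H"
    and rem: "\<And>x y. \<bar>\<phi> y - \<phi> x - \<psi> x * (y - x)\<bar> \<le> \<bar>y - x\<bar> * \<bar>H y - H x\<bar>"
  shows "\<bar>(\<integral>w. F w * \<phi> (F w) \<partial>M) - (\<integral>w. \<psi> (F w) * (\<Sum>k. Dk p k F w * - Dk p k G w) \<partial>M)\<bar>
    \<le> (\<integral>w. H (F w) * V w \<partial>M)"
proof -
  define u where "u = (\<lambda>k w. (1 / sqrt (p k * qq p k)) * Dk p k F w * \<bar>Dk p k G w\<bar>)"
  define S where "S = (\<lambda>w. \<Sum>k. Dk p k F w * - Dk p k G w)"
  define T where "T = (\<lambda>w. \<Sum>k. Dk p k (\<lambda>w. \<phi> (F w)) w * - Dk p k G w)"
  define R where "R = (\<lambda>w. \<Sum>k. Dk p k (\<lambda>w. H (F w)) w * u k w)"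
  have FL: "F \<in> L2" using F by (simp add: D12_iff)
  then have Fm[measurable]: "F \<in> borel_measurable M" by (simp add: L2_def)
  have GD: "G \<in> D12 p" by (rule Linv_D12[OF FL G])
  have G': "L2_seq (\<lambda>k w. - Dk p k G w)" using GD by (intro L2_seq_uminus) (simp add: D12_iff)
  have F': "L2_seq (\<lambda>k. Dk p k F)" and \<phi>': "L2_seq (\<lambda>k. Dk p k (\<lambda>w. \<phi> (F w)))"
    and H': "L2_seq (\<lambda>k. Dk p k (\<lambda>w. H (F w)))"
    using F \<phi> HF by (auto simp: D12_iff)
  have u': "L2_seq u" using V by (simp add: is_delta_def L2_seq_def u_def)
  have Si: "integrable M S" unfolding S_def by (rule L2_seq_inner_integrable[OF F' G'])
  have Ti: "integrable M T" unfolding T_def by (rule L2_seq_inner_integrable[OF \<phi>' G'])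
  have Ri: "integrable M R" unfolding R_def by (rule L2_seq_inner_integrable[OF H' u'])
  have \<psi>F[measurable]: "(\<lambda>w. \<psi> (F w)) \<in> borel_measurable M"
    using measurable_compose[OF Fm \<psi>(1)] .
  have \<psi>S: "integrable M (\<lambda>w. \<psi> (F w) * S w)"
  proof (rule Bochner_Integration.integrable_bound[of M "\<lambda>w. B * S w"])
    have "0 \<le> B" using \<psi>(2)[of 0] by linarith
    then show "AE w in M. norm (\<psi> (F w) * S w) \<le> norm (B * S w)"
      using \<psi>(2) by (auto simp: abs_mult intro!: mult_right_mono)
  qed (use Si in auto)
  have "AE w in M. \<forall>k. w k = 1 \<or> w k = -1"
    using AE_coord by (simp add: AE_all_countable)
  \<comment> \<open>The three series converge only almost surely; elsewhere \<open>suminf\<close>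
    carries no information.\<close>
  then have ae: "AE w in M. \<bar>T w - \<psi> (F w) * S w\<bar> \<le> R w"
    using L2_seq_mult(2)[OF F' G'] L2_seq_mult(2)[OF \<phi>' G'] L2_seq_mult(2)[OF H' u']
  proof eventually_elim
    case (elim w)
    note sm = elim(2-4)[THEN summable_norm_cancel]
    have "T w - \<psi> (F w) * S w =
        (\<Sum>k. Dk p k (\<lambda>w. \<phi> (F w)) w * - Dk p k G w - \<psi> (F w) * (Dk p k F w * - Dk p k G w))"
      unfolding T_def S_def suminf_mult[OF sm(1), symmetric]
      by (intro suminf_diff sm summable_mult)
    also have "\<bar>\<dots>\<bar> \<le> R w"
      unfolding R_def real_norm_def[symmetric]
    proof (rule norm_suminf_le[OF _ sm(3)])
      fix k
      have "\<bar>Dk p k (\<lambda>w. \<phi> (F w)) w - \<psi> (F w) * Dk p k F w\<bar> * \<bar>Dk p k G w\<bar>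
        \<le> (1 / sqrt (p k * qq p k)) * Dk p k F w * Dk p k (\<lambda>w. H (F w)) w * \<bar>Dk p k G w\<bar>"
        using elim(1) by (intro mult_right_mono Dk_chain_remainder H rem) auto
      moreover have "norm (Dk p k (\<lambda>w. \<phi> (F w)) w * - Dk p k G w - \<psi> (F w) * (Dk p k F w * - Dk p k G w))
        = \<bar>Dk p k (\<lambda>w. \<phi> (F w)) w - \<psi> (F w) * Dk p k F w\<bar> * \<bar>Dk p k G w\<bar>"
        unfolding abs_mult[symmetric] real_norm_def
        by (subst abs_minus_cancel[symmetric]) (simp add: algebra_simps)
      ultimately show "norm (Dk p k (\<lambda>w. \<phi> (F w)) w * - Dk p k G w - \<psi> (F w) * (Dk p k F w * - Dk p k G w))
        \<le> Dk p k (\<lambda>w. H (F w)) w * u k w"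
        by (simp add: u_def mult_ac)
    qed
    finally show ?case .
  qed
  have "(\<integral>w. F w * \<phi> (F w) \<partial>M) = (\<integral>w. T w \<partial>M)"
    unfolding T_def using integration_by_parts[OF FL mean0 G \<phi>] by simp
  then have "\<bar>(\<integral>w. F w * \<phi> (F w) \<partial>M) - (\<integral>w. \<psi> (F w) * S w \<partial>M)\<bar> = \<bar>\<integral>w. T w - \<psi> (F w) * S w \<partial>M\<bar>"
    using Ti \<psi>S by simp
  also have "\<dots> \<le> (\<integral>w. \<bar>T w - \<psi> (F w) * S w\<bar> \<partial>M)"
    by (rule integral_abs_bound)
  also have "\<dots> \<le> (\<integral>w. R w \<partial>M)"
    using ae Ti \<psi>S Ri by (intro integral_mono_AE) auto
  \<comment> \<open>The duality relation, tested with \<open>H(F)\<close>.\<close>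
  also have "\<dots> = (\<integral>w. H (F w) * V w \<partial>M)"
    using V HF by (auto simp: R_def u_def is_delta_def)
  finally show ?thesis by (simp add: S_def)
qed

end

section \<open>The normal distribution and the Stein equation\<close>

lemma std_normal_density_has_real_derivative [derivative_intros]:
  "(std_normal_density has_real_derivative - x * std_normal_density x) (at x)"
proof -
  have "((\<lambda>x. exp (- x\<^sup>2 / 2)) has_real_derivative - x * exp (- x\<^sup>2 / 2)) (at x)"
    by (auto intro!: derivative_eq_intros)
  then have "((\<lambda>x. 1 / sqrt (2 * pi) * exp (- x\<^sup>2 / 2)) has_real_derivative
      1 / sqrt (2 * pi) * (- x * exp (- x\<^sup>2 / 2))) (at x)"
    by (rule DERIV_cmult)
  then show ?thesis
    unfolding std_normal_density_def[abs_def] by (simp only: mult.left_commute[of "- x"])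
qed

lemma inverse_std_normal_density: "1 / std_normal_density x = sqrt (2 * pi) * exp (x\<^sup>2 / 2)"
  by (simp add: std_normal_density_def exp_minus field_simps)

lemma continuous_on_std_normal_density: "continuous_on A std_normal_density"
  unfolding std_normal_density_def[abs_def] by (auto intro!: continuous_intros)

lemma tendsto_id_mult_std_normal_density: "((\<lambda>x. x * std_normal_density x) \<longlongrightarrow> 0) at_top"
proof (rule tendsto_sandwich)
  show "\<forall>\<^sub>F x in at_top. 0 \<le> x * std_normal_density x"
    using eventually_ge_at_top[of 0] by eventually_elim simp
  show "\<forall>\<^sub>F x in at_top. x * std_normal_density x \<le> (2 / sqrt (2 * pi)) / x"
    using eventually_gt_at_top[of 0]
  proof eventually_elim
    case (elim x)
    have "x\<^sup>2 / 2 \<le> exp (x\<^sup>2 / 2)"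
      using exp_ge_add_one_self[of "x\<^sup>2 / 2"] by linarith
    then have "exp (- x\<^sup>2 / 2) \<le> 2 / x\<^sup>2"
      using elim by (simp add: exp_minus field_simps)
    then have "x * (exp (- x\<^sup>2 / 2) / sqrt (2 * pi)) \<le> x * ((2 / x\<^sup>2) / sqrt (2 * pi))"
      using elim by (intro mult_left_mono divide_right_mono) auto
    also have "\<dots> = (2 / sqrt (2 * pi)) / x"
      using elim by (simp add: power2_eq_square)
    finally show ?case by (simp add: std_normal_density_def)
  qed
  show "((\<lambda>x. (2 / sqrt (2 * pi)) / x) \<longlongrightarrow> (0::real)) at_top"
    by (intro tendsto_divide_0[OF tendsto_const] filterlim_mono[OF filterlim_ident order.refl at_top_le_at_infinity])
qed simp

lemma Phi_eq_cdf: "Phi = cdf std_normal_distribution"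
proof
  fix z :: real
  interpret N: real_distribution std_normal_distribution by (rule real_dist_normal_dist)
  have "cdf std_normal_distribution z = (\<integral>x. indicator {..z} x \<partial>std_normal_distribution)"
    by (simp add: cdf_def)
  also have "\<dots> = (\<integral>x. std_normal_density x * indicator {..z} x \<partial>lborel)"
    by (subst integral_density) auto
  also have "\<dots> = Phi z"
    by (simp add: Phi_def set_lebesgue_integral_def mult.commute)
  finally show "Phi z = cdf std_normal_distribution z" ..
qed

lemma Phi_tendsto_at_top: "(Phi \<longlongrightarrow> 1) at_top"
proof -
  interpret N: real_distribution std_normal_distribution by (rule real_dist_normal_dist)
  show ?thesis unfolding Phi_eq_cdf by (rule N.cdf_lim_at_top_prob)
qed

lemma Phi_tendsto_at_bot: "(Phi \<longlongrightarrow> 0) at_bot"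
proof -
  interpret N: real_distribution std_normal_distribution by (rule real_dist_normal_dist)
  show ?thesis unfolding Phi_eq_cdf by (rule N.cdf_lim_at_bot)
qed

text \<open>Splitting off the constant mass below \<open>x - 1\<close> leaves an integral over a
  compact interval, to which the fundamental theorem of calculus applies.\<close>

lemma Phi_has_real_derivative [derivative_intros]:
  "(Phi has_real_derivative std_normal_density x) (at x)"
proof -
  let ?a = "x - 1" and ?b = "x + 1"
  have int: "set_integrable lborel A std_normal_density" if "A \<in> sets borel" for A
    using integrable_normal_density[of 1 0] that
    unfolding set_integrable_def by (intro integrable_mult_indicator) auto
  have eq: "Phi u = Phi ?a + integral {?a..u} std_normal_density" if u: "u \<in> {?a..?b}" for u
  proof -
    have "{..u} = {..?a} \<union> {?a..u}" using u by auto
    then have "Phi u = (LBINT y:{..?a} \<union> {?a..u}. std_normal_density y)"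
      by (simp add: Phi_def)
    also have "\<dots> = Phi ?a + (LBINT y:{?a..u}. std_normal_density y)"
      unfolding Phi_def
    proof (rule set_integral_Un_AE)
      have "AE y in lborel. y \<noteq> ?a" by (rule AE_lborel_singleton)
      then show "AE y in lborel. \<not> (y \<in> {..?a} \<and> y \<in> {?a..u})"
        by eventually_elim auto
    qed (auto intro: int)
    also have "(LBINT y:{?a..u}. std_normal_density y) = integral {?a..u} std_normal_density"
      by (intro set_borel_integral_eq_integral int) auto
    finally show ?thesis .
  qed
  have "((\<lambda>u. integral {?a..u} std_normal_density) has_real_derivative std_normal_density x) (at x within {?a..?b})"
    by (rule integral_has_real_derivative) (auto simp: continuous_on_std_normal_density)
  then have "((\<lambda>u. Phi ?a + integral {?a..u} std_normal_density) has_real_derivative 0 + std_normal_density x) (at x within {?a..?b})"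
    by (intro DERIV_add DERIV_const)
  then have "(Phi has_real_derivative std_normal_density x) (at x within {?a..?b})"
    unfolding add_0
  proof (rule has_field_derivative_transform_within[where d=1])
    show "Phi ?a + integral {?a..u} std_normal_density = Phi u" if "u \<in> {?a..?b}" for u
      by (rule eq[OF that, symmetric])
  qed auto
  moreover have "at x within {?a..?b} = at x"
    by (rule at_within_interior) auto
  ultimately show ?thesis by simp
qed

lemma Phi_less_1: "Phi x < 1"
proof -
  have "-1 < - Phi x"
  proof (rule DERIV_neg_imp_decreasing_at_top[where f="\<lambda>x. - Phi x"])
    show "\<exists>y. ((\<lambda>x. - Phi x) has_real_derivative y) (at x) \<and> y < 0" for x
      by (rule exI[of _ "- std_normal_density x"])
         (auto intro!: derivative_eq_intros simp: normal_density_pos)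
    show "((\<lambda>x. - Phi x) \<longlongrightarrow> -1) at_top"
      by (intro tendsto_minus Phi_tendsto_at_top)
  qed
  then show ?thesis by simp
qed

lemma Phi_pos: "0 < Phi x"
proof (rule DERIV_pos_imp_increasing_at_bot[OF _ Phi_tendsto_at_bot])
  show "\<exists>y. (Phi has_real_derivative y) (at x) \<and> y > 0" for x
    using Phi_has_real_derivative normal_density_pos[of 1 0 x] by auto
qed

lemma Phi_minus: "Phi (- x) = 1 - Phi x"
proof -
  define g where "g x = Phi x + Phi (- x)" for x
  have "(g has_real_derivative 0) (at x)" for x
  proof -
    have "((\<lambda>x. Phi (- x)) has_real_derivative std_normal_density (- x) * - 1) (at x)"
      by (rule DERIV_chain2[where f=Phi, OF Phi_has_real_derivative]) (auto intro!: derivative_eq_intros)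
    then have "(g has_real_derivative std_normal_density x + std_normal_density (- x) * - 1) (at x)"
      unfolding g_def by (intro DERIV_add Phi_has_real_derivative)
    then show ?thesis by (simp add: std_normal_density_def)
  qed
  then have const: "g y = g x" for y
    using DERIV_isconst_all by blast
  have "(g \<longlongrightarrow> 1 + 0) at_top"
    unfolding g_def
    by (intro tendsto_add Phi_tendsto_at_top filterlim_compose[OF Phi_tendsto_at_bot filterlim_uminus_at_bot_at_top])
  moreover have "g = (\<lambda>_. g x)" using const by auto
  ultimately have "((\<lambda>_. g x) \<longlongrightarrow> 1) (at_top :: real filter)" by (metis add_0_right)
  then have "g x = 1" by (simp add: tendsto_const_iff)
  then show ?thesis by (simp add: g_def)
qed

text \<open>The Mills ratio. It solves y' = xy - 1, and both branches of \<open>fz\<close> are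
  multiples of it, at \<open>- w\<close> below \<open>z\<close> and at \<open>w\<close>
  above.\<close>

definition mills :: "real \<Rightarrow> real" where
  "mills x = (1 - Phi x) / std_normal_density x"

lemma mills_pos: "0 < mills x"
  using Phi_less_1[of x] normal_density_pos[of 1 0 x] by (simp add: mills_def)

lemma mills_minus: "mills (- x) = Phi x / std_normal_density x"
  by (simp add: mills_def Phi_minus std_normal_density_def)

lemma mills_has_real_derivative [derivative_intros]:
  "(mills has_real_derivative x * mills x - 1) (at x)"
proof -
  have "((\<lambda>x. (1 - Phi x) / std_normal_density x) has_real_derivative
      ((0 - std_normal_density x) * std_normal_density x - (1 - Phi x) * (- x * std_normal_density x))
        / (std_normal_density x * std_normal_density x)) (at x)"
    using normal_density_pos[of 1 0 x]
    by (intro DERIV_divide DERIV_diff DERIV_const derivative_intros) auto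
  moreover have "((0 - std_normal_density x) * std_normal_density x - (1 - Phi x) * (- x * std_normal_density x))
        / (std_normal_density x * std_normal_density x) = x * mills x - 1"
    using normal_density_pos[of 1 0 x] by (simp add: mills_def field_simps)
  ultimately show ?thesis unfolding mills_def[abs_def] by simp
qed

text \<open>For positive x, density/x minus the normal tail has derivative -density/x^2 and tends to
  0 at infinity, so it is positive. For the remaining x the left side is not positive.\<close>

lemma mills_upper: "x * mills x < 1"
proof (cases "x > 0")
  case True
  have "0 < std_normal_density x / x - (1 - Phi x)"
  proof (rule DERIV_neg_imp_decreasing_at_top[where f="\<lambda>x. std_normal_density x / x - (1 - Phi x)"])
    fix y assume y: "x \<le> y"
    have "((\<lambda>x. std_normal_density x / x - (1 - Phi x)) has_real_derivative
        (- y * std_normal_density y * y - std_normal_density y * 1) / (y * y) - (0 - std_normal_density y)) (at y)"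
      using y True by (intro DERIV_diff DERIV_divide DERIV_const DERIV_ident derivative_intros) auto
    moreover have "(- y * std_normal_density y * y - std_normal_density y * 1) / (y * y) - (0 - std_normal_density y)
        = - (std_normal_density y / (y * y))"
      using y True by (simp add: field_simps)
    moreover have "- (std_normal_density y / (y * y)) < 0"
      using y True normal_density_pos[of 1 0 y] by simp
    ultimately show "\<exists>d. ((\<lambda>x. std_normal_density x / x - (1 - Phi x)) has_real_derivative d) (at y) \<and> d < 0"
      by metis
  next
    have "((\<lambda>x. (x * std_normal_density x) / (x * x)) \<longlongrightarrow> 0) at_top"
      by (intro tendsto_divide_0[OF tendsto_id_mult_std_normal_density] filterlim_mono[OF _ at_top_le_at_infinity order.refl]
          filterlim_at_top_mult_at_top filterlim_ident)
    then have "((\<lambda>x. std_normal_density x / x) \<longlongrightarrow> 0) at_top"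
      by (rule Lim_transform_eventually) (use eventually_gt_at_top[of 0] in eventually_elim, simp)
    then have "((\<lambda>x. std_normal_density x / x - (1 - Phi x)) \<longlongrightarrow> 0 - (1 - 1)) at_top"
      by (intro tendsto_diff tendsto_const Phi_tendsto_at_top)
    then show "((\<lambda>x. std_normal_density x / x - (1 - Phi x)) \<longlongrightarrow> 0) at_top" by simp
  qed
  then show ?thesis
    using True normal_density_pos[of 1 0 x] by (simp add: mills_def field_simps)
next
  case False
  then have "x * mills x \<le> 0" using mills_pos[of x] by (simp add: mult_nonpos_nonneg)
  then show ?thesis by simp
qed

text \<open>The same scheme one order further: the derivative of (1 + x^2)(1 - Phi) - x density is
  negative by \<open>mills_upper\<close>. The inequality says exactly that x times the Mills ratio
  has positive derivative.\<close>

lemma mills_lower: "x < (1 + x\<^sup>2) * mills x"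
proof -
  have up: "y * (1 - Phi y) < std_normal_density y" for y
    using mills_upper[of y] normal_density_pos[of 1 0 y] by (simp add: mills_def field_simps)
  have "0 < (1 + x\<^sup>2) * (1 - Phi x) - x * std_normal_density x"
  proof (rule DERIV_neg_imp_decreasing_at_top[where f="\<lambda>x. (1 + x\<^sup>2) * (1 - Phi x) - x * std_normal_density x"])
    fix y
    have "((\<lambda>x. (1 + x\<^sup>2) * (1 - Phi x) - x * std_normal_density x) has_real_derivative
        2 * (y * (1 - Phi y) - std_normal_density y)) (at y)"
      by (auto intro!: derivative_eq_intros simp: algebra_simps power2_eq_square)
    then show "\<exists>d. ((\<lambda>x. (1 + x\<^sup>2) * (1 - Phi x) - x * std_normal_density x) has_real_derivative d) (at y) \<and> d < 0"
      using up[of y] by (intro exI conjI) auto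
  next
    have sq: "((\<lambda>x. x\<^sup>2 * (1 - Phi x)) \<longlongrightarrow> 0) at_top"
    proof (rule tendsto_sandwich[OF _ _ tendsto_const tendsto_id_mult_std_normal_density])
      show "\<forall>\<^sub>F x in at_top. 0 \<le> x\<^sup>2 * (1 - Phi x)"
        by (intro always_eventually allI mult_nonneg_nonneg) (auto simp: less_imp_le[OF Phi_less_1])
      show "\<forall>\<^sub>F x in at_top. x\<^sup>2 * (1 - Phi x) \<le> x * std_normal_density x"
        using eventually_ge_at_top[of 0]
      proof eventually_elim
        case (elim x)
        then show ?case
          using mult_left_mono[OF less_imp_le[OF up[of x]], of x] by (simp add: power2_eq_square mult.assoc)
      qed
    qed
    have "((\<lambda>x. (1 - Phi x) + x\<^sup>2 * (1 - Phi x) - x * std_normal_density x) \<longlongrightarrow> (1 - 1) + 0 - 0) at_top"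
      by (intro tendsto_intros sq Phi_tendsto_at_top tendsto_id_mult_std_normal_density)
    then show "((\<lambda>x. (1 + x\<^sup>2) * (1 - Phi x) - x * std_normal_density x) \<longlongrightarrow> 0) at_top"
      by (simp add: algebra_simps)
  qed
  then show ?thesis
    using normal_density_pos[of 1 0 x] by (simp add: mills_def field_simps)
qed

lemma mono_id_mult_mills: "mono (\<lambda>x. x * mills x)"
proof (rule monoI)
  fix a b :: real assume "a \<le> b"
  then show "a * mills a \<le> b * mills b"
  proof (rule DERIV_nonneg_imp_nondecreasing[where f="\<lambda>x. x * mills x"])
    fix x
    have "((\<lambda>x. x * mills x) has_real_derivative (1 + x\<^sup>2) * mills x - x) (at x)"
      by (auto intro!: derivative_eq_intros simp: algebra_simps power2_eq_square)
    then show "\<exists>y. ((\<lambda>x. x * mills x) has_real_derivative y) (at x) \<and> 0 \<le> y"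
      using mills_lower[of x] by (intro exI conjI) auto
  qed
qed

text \<open>\<open>mills_lower\<close> degenerates at 0. Below 1 it is replaced by monotonicity of
  the Mills ratio and its lower bound 1/2 at the point 1.\<close>

lemma mills_half:
  assumes "0 \<le> z"
  shows "1 / 2 \<le> (1 + z\<^sup>2) * mills z"
proof (cases "1 \<le> z")
  case True
  then show ?thesis using mills_lower[of z] by linarith
next
  case False
  have "mills 1 \<le> mills z"
  proof (rule DERIV_nonpos_imp_nonincreasing[where f=mills])
    show "z \<le> 1" using False by simp
    show "\<exists>y. (mills has_real_derivative y) (at x) \<and> y \<le> 0" for x
      using mills_has_real_derivative mills_upper[of x] by (intro exI conjI) auto
  qed
  then have "1 / 2 \<le> mills z" using mills_lower[of 1] by simp
  also have "\<dots> \<le> (1 + z\<^sup>2) * mills z"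
    using mills_pos[of z] by (simp add: algebra_simps)
  finally show ?thesis .
qed

text \<open>Converts the Gaussian factor left by the region \<open>w > z\<close> into a multiple of
  the tail \<open>1 - Phi z\<close>, so that the final error is relative.\<close>

lemma exp_le_Phi_tail:
  assumes "0 \<le> z"
  shows "exp (- z\<^sup>2 / 2) \<le> 2 * sqrt (2 * pi) * (1 + z\<^sup>2) * (1 - Phi z)"
proof -
  have "exp (- z\<^sup>2 / 2) = sqrt (2 * pi) * std_normal_density z"
    by (simp add: std_normal_density_def)
  also have "\<dots> \<le> sqrt (2 * pi) * (2 * (1 + z\<^sup>2) * (1 - Phi z))"
    using mills_half[OF assms] normal_density_pos[of 1 0 z]
    by (intro mult_left_mono) (simp_all add: mills_def field_simps)
  finally show ?thesis by (simp only: mult_ac)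
qed

section \<open>The Stein solution, its monotone majorant and its bounds\<close>

lemma fz_mills: "fz z w = (if w \<le> z then (1 - Phi z) * mills (- w) else Phi z * mills w)"
  unfolding mills_minus by (simp add: fz_def mills_def)

text \<open>\<open>fz z\<close> has a kink at \<open>z\<close>; there \<open>fz' z\<close> is the value prescribed by the Stein equation.\<close>

definition fz' :: "real \<Rightarrow> real \<Rightarrow> real" where
  "fz' z w = w * fz z w + (if w \<le> z then 1 else 0) - Phi z"

text \<open>Up to a constant, \<open>fz'\<close> is \<open>w * fz z w\<close> minus the indicator of
  \<open>w > z\<close>. Reversing the sign of the indicator makes both summands
  nondecreasing.\<close>

definition fzH :: "real \<Rightarrow> real \<Rightarrow> real" where
  "fzH z w = w * fz z w + (if w > z then 1 else 0)"

lemma continuous_on_fz: "continuous_on A (fz z)"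
proof -
  have m: "continuous_on A mills" for A
    using mills_has_real_derivative by (auto intro!: DERIV_continuous_on[of A mills] intro: has_field_derivative_at_within)
  have "continuous_on ({..z} \<union> {z..}) (\<lambda>w. if w \<le> z then (1 - Phi z) * mills (- w) else Phi z * mills w)"
  proof (rule continuous_on_If)
    show "continuous_on {..z} (\<lambda>w. (1 - Phi z) * mills (- w))"
      by (intro continuous_intros continuous_on_compose2[OF m]) auto
    show "continuous_on {z..} (\<lambda>w. Phi z * mills w)"
      by (intro continuous_intros m)
    show "(1 - Phi z) * mills (- w) = Phi z * mills w" if "w \<in> {..z}" "\<not> w \<le> z" for w
      using that by simp
    show "(1 - Phi z) * mills (- w) = Phi z * mills w" if "w \<in> {z..}" "w \<le> z" for w
    proof -
      have "w = z" using that by simp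
      then show ?thesis unfolding mills_minus by (simp add: mills_def)
    qed
  qed auto
  moreover have "{..z} \<union> {z..} = UNIV" by auto
  moreover have "fz z = (\<lambda>w. if w \<le> z then (1 - Phi z) * mills (- w) else Phi z * mills w)"
    by (simp add: fun_eq_iff fz_mills)
  ultimately have "continuous_on UNIV (fz z)" by simp
  then show ?thesis by (rule continuous_on_subset) simp
qed

lemma fz_has_real_derivative:
  assumes "w \<noteq> z"
  shows "(fz z has_real_derivative fz' z w) (at w)"
proof (cases "w < z")
  case True
  have "((\<lambda>w. mills (- w)) has_real_derivative ((- w) * mills (- w) - 1) * - 1) (at w)"
    by (rule DERIV_chain2[where f=mills, OF mills_has_real_derivative]) (auto intro!: derivative_eq_intros)
  then have "((\<lambda>w. (1 - Phi z) * mills (- w)) has_real_derivative (1 - Phi z) * (((- w) * mills (- w) - 1) * - 1)) (at w)"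
    by (intro DERIV_cmult)
  also have "(1 - Phi z) * (((- w) * mills (- w) - 1) * - 1) = fz' z w"
    using True by (simp add: fz'_def fz_mills algebra_simps)
  finally show ?thesis
    by (rule has_field_derivative_transform_within_open[of _ _ _ "{..<z}"]) (use True in \<open>auto simp: fz_mills\<close>)
next
  case False
  then have w: "w > z" using assms by simp
  have "((\<lambda>w. Phi z * mills w) has_real_derivative Phi z * (w * mills w - 1)) (at w)"
    by (intro DERIV_cmult mills_has_real_derivative)
  also have "Phi z * (w * mills w - 1) = fz' z w"
    using w by (simp add: fz'_def fz_mills algebra_simps)
  finally show ?thesis
    by (rule has_field_derivative_transform_within_open[of _ _ _ "{z<..}"]) (use w in \<open>auto simp: fz_mills\<close>)
qed

text \<open>On either side of \<open>z\<close> this is \<open>mono_id_mult_mills\<close>, reflected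
  through the origin on the left; the two branches agree at \<open>z\<close>.\<close>

lemma mono_id_mult_fz: "mono (\<lambda>w. w * fz z w)"
proof (rule monoI)
  fix a b :: real assume ab: "a \<le> b"
  have left: "a * fz z a \<le> b * fz z b" if "a \<le> b" "b \<le> z" for a b
  proof -
    have "(- b) * mills (- b) \<le> (- a) * mills (- a)"
      using monoD[OF mono_id_mult_mills, of "- b" "- a"] that by simp
    then have "(1 - Phi z) * (a * mills (- a)) \<le> (1 - Phi z) * (b * mills (- b))"
      using Phi_less_1[of z] by (intro mult_left_mono) auto
    then show ?thesis using that by (simp add: fz_mills mult.left_commute)
  qed
  have fz_z: "fz z z = Phi z * mills z"
    unfolding fz_mills mills_minus by (simp add: mills_def)
  have right: "a * fz z a \<le> b * fz z b" if "z \<le> a" "a \<le> b" for a b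
  proof -
    have "Phi z * (a * mills a) \<le> Phi z * (b * mills b)"
      using monoD[OF mono_id_mult_mills, of a b] that Phi_pos[of z] by (intro mult_left_mono) auto
    moreover have "fz z x = Phi z * mills x" if "z \<le> x" for x
      using that fz_z by (cases "x = z") (auto simp: fz_mills)
    ultimately show ?thesis using that by (simp add: mult.left_commute)
  qed
  show "a * fz z a \<le> b * fz z b"
    using left[of a b] left[of a z] right[of z b] right[of a b] ab by linarith
qed

lemma mono_fzH: "mono (fzH z)"
  unfolding fzH_def using monoD[OF mono_id_mult_fz] by (auto intro!: monoI add_mono)

text \<open>With \<open>a\<close> and \<open>i\<close> nondecreasing, \<open>fz'\<close> has the
  increments of \<open>a - i\<close> and \<open>fzH\<close> those of \<open>a + i\<close>. An
  increment over part of an interval is dominated by the one over all of it.\<close>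

lemma fz'_diff_le:
  assumes "s \<in> {min x y..max x y}"
  shows "\<bar>fz' z s - fz' z x\<bar> \<le> \<bar>fzH z y - fzH z x\<bar>"
proof -
  define a where "a w = w * fz z w" for w
  define i where "i w = (if w > z then 1 else 0 :: real)" for w
  have f: "fz' z s - fz' z x = (a s - a x) - (i s - i x)"
    by (simp add: fz'_def a_def i_def)
  have H: "fzH z y - fzH z x = (a y - a x) + (i y - i x)"
    by (simp add: fzH_def a_def i_def)
  have am: "a v \<le> a w" and im: "i v \<le> i w" if "v \<le> w" for v w
    using monoD[OF mono_id_mult_fz that] that by (auto simp: a_def i_def)
  show ?thesis
  proof (cases "x \<le> y")
    case True
    then have "a x \<le> a s" "a s \<le> a y" "i x \<le> i s" "i s \<le> i y"
      using assms by (auto intro!: am im)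
    then show ?thesis unfolding f H by linarith
  next
    case False
    then have "a y \<le> a s" "a s \<le> a x" "i y \<le> i s" "i s \<le> i x"
      using assms by (auto intro!: am im)
    then show ?thesis unfolding f H by linarith
  qed
qed

text \<open>A mean value inequality with one exceptional point, the kink. Taking \<open>c\<close> as
  the slope at \<open>x\<close> gives Taylor remainders; \<open>c = 0\<close> gives Lipschitz
  bounds.\<close>

lemma increment_bound:
  fixes f g :: "real \<Rightarrow> real"
  assumes cont: "continuous_on UNIV f"
    and der: "\<And>x. x \<noteq> z \<Longrightarrow> (f has_real_derivative g x) (at x)"
    and bnd: "\<And>s. s \<in> {min x y..max x y} \<Longrightarrow> \<bar>g s - c\<bar> \<le> B"
  shows "\<bar>f y - f x - c * (y - x)\<bar> \<le> \<bar>y - x\<bar> * B"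
proof -
  have main: "\<bar>f b - f a - c * (b - a)\<bar> \<le> B * (b - a)"
    if ab: "a \<le> b" and bnd: "\<And>s. s \<in> {a..b} \<Longrightarrow> \<bar>g s - c\<bar> \<le> B" for a b
  proof -
    have "((\<lambda>s. g s - c) has_integral ((f b - c * b) - (f a - c * a))) {a..b}"
    proof (rule fundamental_theorem_of_calculus_interior_strong[of "{z}"])
      fix x assume "x \<in> {a<..<b} - {z}"
      then have "((\<lambda>x. f x - c * x) has_real_derivative g x - c) (at x)"
        by (auto intro!: derivative_eq_intros der)
      then show "((\<lambda>x. f x - c * x) has_vector_derivative g x - c) (at x)"
        by (simp add: has_real_derivative_iff_has_vector_derivative)
    qed (use ab in \<open>auto intro!: continuous_intros continuous_on_subset[OF cont]\<close>)
    then have "norm ((f b - c * b) - (f a - c * a)) \<le> B * measure lborel {a..b}"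
      using bnd ab bnd[of a] by (intro has_integral_bound_real[of _ "{}"]) (auto intro: order.trans[OF abs_ge_zero])
    then show ?thesis using ab by (simp add: algebra_simps)
  qed
  show ?thesis
  proof (cases "x \<le> y")
    case True
    then show ?thesis using main[of x y] bnd by (simp add: mult.commute)
  next
    case False
    then have "\<bar>f x - f y - c * (x - y)\<bar> \<le> B * (x - y)" using main[of y x] bnd by simp
    moreover have "\<bar>f y - f x - c * (y - x)\<bar> = \<bar>f x - f y - c * (x - y)\<bar>"
      by (subst abs_minus_cancel[symmetric]) (simp add: algebra_simps)
    ultimately show ?thesis using False by (simp add: mult.commute)
  qed
qed

lemma fz_remainder:
  "\<bar>fz z y - fz z x - fz' z x * (y - x)\<bar> \<le> \<bar>y - x\<bar> * \<bar>fzH z y - fzH z x\<bar>"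
  by (rule increment_bound[OF continuous_on_fz fz_has_real_derivative]) (auto intro: fz'_diff_le)

text \<open>A common majorant of |fz'| and |fzH|. The middle term is w divided by the density; the
  factor \<open>1 - Phi z\<close> is kept in front because the final error is relative to
  it.\<close>

definition fz_bound :: "real \<Rightarrow> real \<Rightarrow> real" where
  "fz_bound z w = (1 - Phi z) * (1 + (if 0 < w \<and> w \<le> z then sqrt (2 * pi) * (w * exp (w\<^sup>2 / 2)) else 0))
    + (if w > z then 2 else 0)"

text \<open>For \<open>w \<le> 0\<close> and for \<open>w > z\<close>, \<open>mills_upper\<close>
  bounds the product of w and the Mills ratio by 1 in absolute value. In between,
  \<open>mills (- w)\<close> grows like the inverse density, and \<open>Phi w \<le> 1\<close> gives
  the middle term.\<close>

lemma fz'_fzH_bound: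
  assumes "0 \<le> z"
  shows "\<bar>fz' z w\<bar> \<le> fz_bound z w" and "\<bar>fzH z w\<bar> \<le> fz_bound z w"
proof -
  have P: "0 < 1 - Phi z" "0 < Phi z" "Phi z < 1" using Phi_less_1[of z] Phi_pos[of z] by auto
  have "\<bar>fz' z w\<bar> \<le> fz_bound z w \<and> \<bar>fzH z w\<bar> \<le> fz_bound z w"
  proof (cases "w \<le> z")
    case True
    have f': "fz' z w = (1 - Phi z) * (1 + w * mills (- w))"
      and H: "fzH z w = (1 - Phi z) * (w * mills (- w))"
      using True by (simp_all add: fz'_def fzH_def fz_mills algebra_simps)
    show ?thesis
    proof (cases "w \<le> 0")
      case w: True
      have "w * mills (- w) \<le> 0" using w mills_pos[of "- w"] by (simp add: mult_nonpos_nonneg)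
      then have "\<bar>1 + w * mills (- w)\<bar> \<le> 1" "\<bar>w * mills (- w)\<bar> \<le> 1"
        using mills_upper[of "- w"] by auto
      then have "\<bar>1 - Phi z\<bar> * \<bar>1 + w * mills (- w)\<bar> \<le> (1 - Phi z) * 1"
        "\<bar>1 - Phi z\<bar> * \<bar>w * mills (- w)\<bar> \<le> (1 - Phi z) * 1"
        using P by (intro mult_mono; simp)+
      then show ?thesis
        unfolding f' H abs_mult[of "1 - Phi z"] using w True by (simp add: fz_bound_def)
    next
      case w: False
      have "mills (- w) \<le> 1 / std_normal_density w"
        unfolding mills_minus using P normal_density_pos[of 1 0 w] Phi_less_1[of w]
        by (intro divide_right_mono) auto
      then have "w * mills (- w) \<le> w * (sqrt (2 * pi) * exp (w\<^sup>2 / 2))"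
        unfolding inverse_std_normal_density using w by (intro mult_left_mono) auto
      moreover have "0 \<le> w * mills (- w)" using w mills_pos[of "- w"] by simp
      ultimately have "\<bar>1 + w * mills (- w)\<bar> \<le> 1 + sqrt (2 * pi) * (w * exp (w\<^sup>2 / 2))"
        "\<bar>w * mills (- w)\<bar> \<le> 1 + sqrt (2 * pi) * (w * exp (w\<^sup>2 / 2))"
        by (auto simp: mult.left_commute[of w])
      then have "\<bar>1 - Phi z\<bar> * \<bar>1 + w * mills (- w)\<bar> \<le> (1 - Phi z) * (1 + sqrt (2 * pi) * (w * exp (w\<^sup>2 / 2)))"
        "\<bar>1 - Phi z\<bar> * \<bar>w * mills (- w)\<bar> \<le> (1 - Phi z) * (1 + sqrt (2 * pi) * (w * exp (w\<^sup>2 / 2)))"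
        using P by (auto intro!: mult_left_mono)
      then show ?thesis
        unfolding f' H abs_mult using w True by (simp add: fz_bound_def)
    qed
  next
    case False
    have f': "fz' z w = Phi z * (w * mills w - 1)" and H: "fzH z w = Phi z * (w * mills w) + 1"
      using False by (simp_all add: fz'_def fzH_def fz_mills algebra_simps)
    have "0 \<le> w * mills w" using False assms mills_pos[of w] by simp
    then have "\<bar>w * mills w - 1\<bar> \<le> 1" "\<bar>w * mills w\<bar> \<le> 1"
      using mills_upper[of w] by auto
    then have "\<bar>Phi z\<bar> * \<bar>w * mills w - 1\<bar> \<le> 1 * 1" "\<bar>Phi z\<bar> * \<bar>w * mills w\<bar> \<le> 1 * 1"
      using P by (intro mult_mono; simp)+
    then have "\<bar>fz' z w\<bar> \<le> 2" "\<bar>fzH z w\<bar> \<le> 2"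
      unfolding f' H abs_mult[symmetric] by auto
    then show ?thesis using False P by (simp add: fz_bound_def)
  qed
  then show "\<bar>fz' z w\<bar> \<le> fz_bound z w" and "\<bar>fzH z w\<bar> \<le> fz_bound z w" by auto
qed

text \<open>A crude bound used qualitatively: it makes \<open>fz\<close> Lipschitz and
  \<open>fz'\<close> bounded, so that the approximate Stein identity applies.\<close>

lemma fz_bound_bounded:
  assumes "0 \<le> z"
  shows "fz_bound z w \<le> 3 + sqrt (2 * pi) * (z * exp (z\<^sup>2 / 2))"
proof -
  have P: "0 < 1 - Phi z" "1 - Phi z < 1" using Phi_less_1[of z] Phi_pos[of z] by auto
  have *: "(if 0 < w \<and> w \<le> z then sqrt (2 * pi) * (w * exp (w\<^sup>2 / 2)) else 0) \<le> sqrt (2 * pi) * (z * exp (z\<^sup>2 / 2))"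
    using assms by (auto intro!: mult_mono power_mono)
  moreover have "0 \<le> (if 0 < w \<and> w \<le> z then sqrt (2 * pi) * (w * exp (w\<^sup>2 / 2)) else 0)" by simp
  ultimately have "(1 - Phi z) * (1 + (if 0 < w \<and> w \<le> z then sqrt (2 * pi) * (w * exp (w\<^sup>2 / 2)) else 0))
      \<le> 1 * (1 + sqrt (2 * pi) * (z * exp (z\<^sup>2 / 2)))"
    using P by (intro mult_mono) auto
  then show ?thesis unfolding fz_bound_def by (auto split: if_splits)
qed

lemma fz_lipschitz:
  assumes "0 \<le> z"
  shows "\<bar>fz z x - fz z y\<bar> \<le> (3 + sqrt (2 * pi) * (z * exp (z\<^sup>2 / 2))) * \<bar>x - y\<bar>"
proof -
  have "\<bar>fz z x - fz z y - 0 * (x - y)\<bar> \<le> \<bar>x - y\<bar> * (3 + sqrt (2 * pi) * (z * exp (z\<^sup>2 / 2)))"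
    using order.trans[OF fz'_fzH_bound(1)[OF assms] fz_bound_bounded[OF assms]]
    by (intro increment_bound[OF continuous_on_fz fz_has_real_derivative]) auto
  then show ?thesis by (simp add: mult.commute)
qed

lemma fz_measurable [measurable]: "fz z \<in> borel_measurable borel"
  by (intro borel_measurable_continuous_onI continuous_on_fz)

lemma fz'_measurable [measurable]: "fz' z \<in> borel_measurable borel"
  unfolding fz'_def[abs_def] by measurable

section \<open>Exponential moments\<close>

text \<open>A backward Euler form of Gronwall: \<open>step\<close> evaluates the rate at the right
  endpoint and neither continuity nor differentiability of \<open>m\<close> is assumed. On a grid of
  mesh z/n the step factors multiply to an exponential that converges as n grows.\<close>

lemma exp_quadratic_Gronwall:
  fixes m :: "real \<Rightarrow> real"
  assumes z: "0 \<le> z" and K: "0 \<le> K" and m0: "m 0 \<le> 1" and pos: "\<And>t. 0 \<le> t \<Longrightarrow> t \<le> z \<Longrightarrow> 0 \<le> m t"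
    and step: "\<And>a b. 0 \<le> a \<Longrightarrow> a \<le> b \<Longrightarrow> b \<le> z \<Longrightarrow> m b - m a \<le> (b - a) * (b * K * m b)"
  shows "m z \<le> exp (K * z\<^sup>2 / 2)"
proof -
  have bound: "m z \<le> exp ((z\<^sup>2 * K / 2) * (1 + inverse (real n)) / (1 - z\<^sup>2 * K * inverse (real n)))"
    if n: "n > 0" "z\<^sup>2 * K < real n" for n
  proof -
    define h where "h = z / real n"
    \<comment> \<open>\<open>e\<close> dominates the quantity \<open>y\<close> of every step. The
      assumption on \<open>n\<close> makes it less than 1, so that each implicit step can be solved
      for its new value.\<close>
    define e where "e = z\<^sup>2 * K / real n"
    have h: "0 \<le> h" using z by (simp add: h_def)
    have e: "0 \<le> e" "e < 1" using n K by (auto simp: e_def)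
    have "m (real j * h) \<le> exp (h\<^sup>2 * K / (1 - e) * (real j * (real j + 1) / 2))" if "j \<le> n" for j
      using that
    proof (induction j)
      case 0
      then show ?case using m0 by simp
    next
      case (Suc j)
      define y where "y = h * (real (Suc j) * h) * K"
      have nh: "real n * h = z" using n by (simp add: h_def)
      have jh: "real (Suc j) * h \<le> z" "real j * h \<le> z"
        unfolding nh[symmetric] using Suc.prems h by (intro mult_right_mono; simp)+
      have "y \<le> h * z * K"
        unfolding y_def using jh h K by (intro mult_right_mono mult_left_mono) auto
      also have "\<dots> = e" by (simp add: h_def e_def power2_eq_square)
      finally have ye: "y \<le> e" .
      have y0: "0 \<le> y" using h K by (simp add: y_def)
      have "m (real (Suc j) * h) - m (real j * h)
          \<le> (real (Suc j) * h - real j * h) * (real (Suc j) * h * K * m (real (Suc j) * h))"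
        using h jh by (intro step) (auto intro: mult_right_mono)
      also have "\<dots> = y * m (real (Suc j) * h)"
        by (simp add: y_def algebra_simps)
      finally have "m (real (Suc j) * h) * (1 - y) \<le> m (real j * h)"
        by (simp add: algebra_simps)
      then have "m (real (Suc j) * h) \<le> m (real j * h) * (1 / (1 - y))"
        using ye e by (simp add: field_simps)
      also have "1 / (1 - y) = 1 + y / (1 - y)"
        using ye e by (simp add: field_simps)
      also have "m (real j * h) * (1 + y / (1 - y)) \<le> m (real j * h) * exp (y / (1 - e))"
      proof (intro mult_left_mono pos)
        have "y / (1 - y) \<le> y / (1 - e)"
          using ye e y0 by (intro divide_left_mono) auto
        then show "1 + y / (1 - y) \<le> exp (y / (1 - e))"
          using exp_ge_add_one_self[of "y / (1 - e)"] by linarith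
      qed (use h jh in auto)
      also have "\<dots> \<le> exp (h\<^sup>2 * K / (1 - e) * (real j * (real j + 1) / 2)) * exp (y / (1 - e))"
        using Suc by (intro mult_right_mono) auto
      also have "\<dots> = exp (h\<^sup>2 * K / (1 - e) * (real (Suc j) * (real (Suc j) + 1) / 2))"
        unfolding exp_add[symmetric] using e
        by (simp add: y_def power2_eq_square divide_simps) (simp add: algebra_simps)
      finally show ?case .
    qed
    from this[of n] have "m (real n * h) \<le> exp (h\<^sup>2 * K / (1 - e) * (real n * (real n + 1) / 2))" by simp
    also have "h\<^sup>2 * K / (1 - e) * (real n * (real n + 1) / 2)
        = (z\<^sup>2 * K / 2) * (1 + inverse (real n)) / (1 - z\<^sup>2 * K * inverse (real n))"
    proof -
      have "h\<^sup>2 * (real n * (real n + 1)) = z\<^sup>2 * (1 + inverse (real n))"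
        using n by (simp add: h_def field_simps power2_eq_square)
      then have "(h\<^sup>2 * (real n * (real n + 1))) * (K / 2) = (z\<^sup>2 * (1 + inverse (real n))) * (K / 2)"
        by (rule arg_cong)
      then have "h\<^sup>2 * K * (real n * (real n + 1) / 2) = (z\<^sup>2 * K / 2) * (1 + inverse (real n))"
        by (simp only: mult_ac times_divide_eq_left times_divide_eq_right)
      moreover have "z\<^sup>2 * K * inverse (real n) = e"
        by (simp only: e_def divide_inverse)
      ultimately show ?thesis by (simp only: times_divide_eq_left)
    qed
    finally show ?thesis using n by (simp add: h_def)
  qed
  have lim: "(\<lambda>n. exp ((z\<^sup>2 * K / 2) * (1 + inverse (real n)) / (1 - z\<^sup>2 * K * inverse (real n))))
      \<longlonglongrightarrow> exp ((z\<^sup>2 * K / 2) * (1 + 0) / (1 - z\<^sup>2 * K * 0))"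
    by (intro tendsto_intros lim_inverse_n) simp
  obtain N where N: "z\<^sup>2 * K < real N" using reals_Archimedean2 by blast
  have "m z \<le> exp ((z\<^sup>2 * K / 2) * (1 + 0) / (1 - z\<^sup>2 * K * 0))"
  proof (rule LIMSEQ_le_const[OF lim], intro exI[of _ "Suc N"] allI impI bound)
    show "z\<^sup>2 * K < real n" if "Suc N \<le> n" for n using N that by linarith
  qed auto
  then show ?thesis by (simp add: mult.commute)
qed

text \<open>\<open>x \<mapsto> e\<^sup>t\<^sup>x\<close> continued linearly beyond \<open>N\<close>: unlike \<open>e\<^sup>t\<^sup>x\<close> itself, this function and its derivative
  are Lipschitz, so that composing them with \<open>F\<close> stays in the domain of \<open>D\<close>.\<close>

definition lin_exp :: "real \<Rightarrow> real \<Rightarrow> real \<Rightarrow> real" where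
  "lin_exp t N x = (if x \<le> N then exp (t * x) else exp (t * N) * (1 + t * (x - N)))"

definition lin_exp' :: "real \<Rightarrow> real \<Rightarrow> real \<Rightarrow> real" where
  "lin_exp' t N x = t * exp (t * min x N)"

lemma continuous_on_lin_exp: "continuous_on UNIV (lin_exp t N)"
proof -
  have "continuous_on ({..N} \<union> {N..}) (\<lambda>x. if x \<le> N then exp (t * x) else exp (t * N) * (1 + t * (x - N)))"
    by (rule continuous_on_If) (auto intro!: continuous_intros)
  moreover have "{..N} \<union> {N..} = UNIV" by auto
  ultimately show ?thesis by (simp add: lin_exp_def[abs_def])
qed

lemma lin_exp_has_real_derivative:
  assumes "x \<noteq> N"
  shows "(lin_exp t N has_real_derivative lin_exp' t N x) (at x)"
proof (cases "x < N")
  case True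
  have "((\<lambda>x. exp (t * x)) has_real_derivative lin_exp' t N x) (at x)"
    using True by (auto intro!: derivative_eq_intros simp: lin_exp'_def min_def)
  then show ?thesis
    by (rule has_field_derivative_transform_within_open[of _ _ _ "{..<N}"])
       (use True in \<open>auto simp: lin_exp_def\<close>)
next
  case False
  then have x: "x > N" using assms by simp
  have "((\<lambda>x. exp (t * N) * (1 + t * (x - N))) has_real_derivative lin_exp' t N x) (at x)"
    using x by (auto intro!: derivative_eq_intros simp: lin_exp'_def min_def)
  then show ?thesis
    by (rule has_field_derivative_transform_within_open[of _ _ _ "{N<..}"])
       (use x in \<open>auto simp: lin_exp_def\<close>)
qed

context
  fixes t :: real
  assumes t: "0 \<le> t"
begin

lemma mono_lin_exp': "mono (lin_exp' t N)"
  unfolding lin_exp'_def using t by (intro monoI mult_left_mono) (auto intro!: mult_left_mono)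

lemma lin_exp'_bounds: "0 \<le> lin_exp' t N x" "lin_exp' t N x \<le> t * exp (t * N)" "lin_exp' t N x \<le> t * exp (t * x)"
  unfolding lin_exp'_def using t by (auto intro!: mult_left_mono)

text \<open>\<open>lin_exp'\<close> is itself nondecreasing, so it acts both as the derivative and
  as the majorant \<open>H\<close>.\<close>

lemma lin_exp_remainder:
  "\<bar>lin_exp t N y - lin_exp t N x - lin_exp' t N x * (y - x)\<bar> \<le> \<bar>y - x\<bar> * \<bar>lin_exp' t N y - lin_exp' t N x\<bar>"
proof (rule increment_bound[OF continuous_on_lin_exp lin_exp_has_real_derivative])
  fix s assume s: "s \<in> {min x y..max x y}"
  show "\<bar>lin_exp' t N s - lin_exp' t N x\<bar> \<le> \<bar>lin_exp' t N y - lin_exp' t N x\<bar>"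
  proof (cases "x \<le> y")
    case True
    then have "lin_exp' t N x \<le> lin_exp' t N s" "lin_exp' t N s \<le> lin_exp' t N y"
      using s by (auto intro!: monoD[OF mono_lin_exp'])
    then show ?thesis by linarith
  next
    case False
    then have "lin_exp' t N y \<le> lin_exp' t N s" "lin_exp' t N s \<le> lin_exp' t N x"
      using s by (auto intro!: monoD[OF mono_lin_exp'])
    then show ?thesis by linarith
  qed
qed

lemma lin_exp_lipschitz: "\<bar>lin_exp t N x - lin_exp t N y\<bar> \<le> t * exp (t * N) * \<bar>x - y\<bar>"
proof -
  have "\<bar>lin_exp t N x - lin_exp t N y - 0 * (x - y)\<bar> \<le> \<bar>x - y\<bar> * (t * exp (t * N))"
    using lin_exp'_bounds(1,2)
    by (intro increment_bound[OF continuous_on_lin_exp lin_exp_has_real_derivative]) auto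
  then show ?thesis by (simp add: mult.commute)
qed

lemma lin_exp'_lipschitz: "\<bar>lin_exp' t N x - lin_exp' t N y\<bar> \<le> t * (t * exp (t * N)) * \<bar>x - y\<bar>"
proof -
  have "\<bar>lin_exp' t N x - lin_exp' t N y - 0 * (x - y)\<bar> \<le> \<bar>x - y\<bar> * (t * (t * exp (t * N)))"
  proof (rule increment_bound[where z=N and g="\<lambda>x. if x < N then t * (t * exp (t * x)) else 0"])
    show "continuous_on UNIV (lin_exp' t N)"
      unfolding lin_exp'_def[abs_def] by (intro continuous_intros)
    show "(lin_exp' t N has_real_derivative (if x < N then t * (t * exp (t * x)) else 0)) (at x)" if "x \<noteq> N" for x
    proof (cases "x < N")
      case True
      have "((\<lambda>x. t * exp (t * x)) has_real_derivative (if x < N then t * (t * exp (t * x)) else 0)) (at x)"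
        using True by (auto intro!: derivative_eq_intros)
      then show ?thesis
        by (rule has_field_derivative_transform_within_open[of _ _ _ "{..<N}"])
           (use True in \<open>auto simp: lin_exp'_def min_def\<close>)
    next
      case False
      then have x: "x > N" using that by simp
      have "((\<lambda>x. t * exp (t * N)) has_real_derivative (if x < N then t * (t * exp (t * x)) else 0)) (at x)"
        using x by (auto intro!: derivative_eq_intros)
      then show ?thesis
        by (rule has_field_derivative_transform_within_open[of _ _ _ "{N<..}"])
           (use x in \<open>auto simp: lin_exp'_def min_def\<close>)
    qed
    show "\<bar>(if s < N then t * (t * exp (t * s)) else 0) - 0\<bar> \<le> t * (t * exp (t * N))" for s
      using t by (auto simp: abs_mult intro!: mult_left_mono)
  qed
  then show ?thesis by (simp add: mult.commute)
qed

lemma lin_exp_tendsto: "(\<lambda>n. lin_exp t (real n) x) \<longlonglongrightarrow> exp (t * x)"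
proof (rule tendsto_eventually)
  obtain n0 where "x \<le> real n0" using real_arch_simple by blast
  then show "\<forall>\<^sub>F n in sequentially. lin_exp t (real n) x = exp (t * x)"
    by (intro eventually_sequentiallyI[of n0]) (auto simp: lin_exp_def)
qed

text \<open>Prepares Fatou's lemma: adding the integrable |F| makes the truncated integrands
  nonnegative. For negative x the truncated exponential is at most 1.\<close>

lemma id_mult_lin_exp_lower:
  assumes "0 \<le> N"
  shows "0 \<le> x * lin_exp t N x + \<bar>x\<bar>"
proof (cases "x \<le> 0")
  case True
  then have "lin_exp t N x \<le> 1" using assms t by (simp add: lin_exp_def mult_nonneg_nonpos)
  then have "x * 1 \<le> x * lin_exp t N x" using True by (intro mult_left_mono_neg) auto
  then show ?thesis using True by simp
next
  case False
  then have "0 \<le> lin_exp t N x" using t by (auto simp: lin_exp_def)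
  then show ?thesis using False by simp
qed

end

lemma lin_exp_measurable [measurable]: "lin_exp t N \<in> borel_measurable borel"
  by (intro borel_measurable_continuous_onI continuous_on_lin_exp)

lemma lin_exp'_measurable [measurable]: "lin_exp' t N \<in> borel_measurable borel"
  unfolding lin_exp'_def[abs_def] by measurable

context rademacher
begin

text \<open>Integrability of F exp(bF) is part of the conclusion because at \<open>b = A\<close> it
  does not follow from exponential moments of order up to \<open>A\<close>. The bound for the
  truncated exponentials is uniform in \<open>N\<close>, and Fatou removes the truncation.\<close>

lemma mgf_derivative_bound:
  fixes F G V :: "(nat \<Rightarrow> real) \<Rightarrow> real"
  defines "T \<equiv> \<lambda>w. 1 - (\<Sum>k. Dk p k F w * - Dk p k G w)"
  assumes F: "F \<in> D12 p" and mean0: "(\<integral>w. F w \<partial>M) = 0" and G: "is_Linv p F G"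
    and V: "is_delta p (\<lambda>k w. (1 / sqrt (p k * qq p k)) * Dk p k F w * \<bar>Dk p k G w\<bar>) V"
    and b: "0 \<le> b" and m: "integrable M (\<lambda>w. exp (b * F w))"
    and T1: "integrable M (\<lambda>w. \<bar>T w\<bar> * exp (b * F w))"
    and T2: "(\<integral>w. \<bar>T w\<bar> * exp (b * F w) \<partial>M) \<le> g1 * (\<integral>w. exp (b * F w) \<partial>M)"
    and V1: "integrable M (\<lambda>w. \<bar>V w\<bar> * exp (b * F w))"
    and V2: "(\<integral>w. \<bar>V w\<bar> * exp (b * F w) \<partial>M) \<le> g2 * (\<integral>w. exp (b * F w) \<partial>M)"
  shows "integrable M (\<lambda>w. F w * exp (b * F w))"
    and "(\<integral>w. F w * exp (b * F w) \<partial>M) \<le> b * (1 + g1 + g2) * (\<integral>w. exp (b * F w) \<partial>M)"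
proof -
  define C where "C = b * (1 + g1 + g2) * (\<integral>w. exp (b * F w) \<partial>M)"
  define S where "S = (\<lambda>w. \<Sum>k. Dk p k F w * - Dk p k G w)"
  have FL: "F \<in> L2" using F by (simp add: D12_iff)
  then have Fm[measurable]: "F \<in> borel_measurable M" by (simp add: L2_def)
  have GD: "G \<in> D12 p" by (rule Linv_D12[OF FL G])
  have VL: "V \<in> L2" using V by (simp add: is_delta_def L2_def)
  have [measurable]: "V \<in> borel_measurable M" using VL by (simp add: L2_def)
  have Si: "integrable M S"
    unfolding S_def using F GD by (intro L2_seq_inner_integrable L2_seq_uminus) (auto simp: D12_iff)
  have le: "(\<integral>w. F w * lin_exp b N (F w) \<partial>M) \<le> C" and int: "integrable M (\<lambda>w. F w * lin_exp b N (F w))" for N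
  proof -
    have \<phi>: "(\<lambda>w. lin_exp b N (F w)) \<in> D12 p"
      by (rule D12_lipschitz[OF F lin_exp_measurable lin_exp_lipschitz[OF b]])
    have \<psi>: "(\<lambda>w. lin_exp' b N (F w)) \<in> D12 p"
      by (rule D12_lipschitz[OF F lin_exp'_measurable lin_exp'_lipschitz[OF b]])
    show "integrable M (\<lambda>w. F w * lin_exp b N (F w))"
      using FL \<phi> by (intro L2_mult_integrable) (auto simp: D12_iff)
    have \<psi>V: "integrable M (\<lambda>w. lin_exp' b N (F w) * V w)"
      using VL \<psi> by (intro L2_mult_integrable) (auto simp: D12_iff)
    have \<psi>b: "\<bar>lin_exp' b N x\<bar> \<le> b * exp (b * N)" for x
      using lin_exp'_bounds(1,2)[OF b, of N x] by simp
    have \<psi>S: "integrable M (\<lambda>w. lin_exp' b N (F w) * S w)"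
    proof (rule Bochner_Integration.integrable_bound[of M "\<lambda>w. (b * exp (b * N)) * S w"])
      have "\<bar>lin_exp' b N (F w)\<bar> * \<bar>S w\<bar> \<le> (b * exp (b * N)) * \<bar>S w\<bar>" for w
        by (intro mult_right_mono \<psi>b) simp
      then show "AE w in M. norm (lin_exp' b N (F w) * S w) \<le> norm ((b * exp (b * N)) * S w)"
        using b by (simp add: abs_mult)
    qed (use Si in auto)
    have "\<bar>(\<integral>w. F w * lin_exp b N (F w) \<partial>M) - (\<integral>w. lin_exp' b N (F w) * S w \<partial>M)\<bar>
        \<le> (\<integral>w. lin_exp' b N (F w) * V w \<partial>M)"
      unfolding S_def
      by (rule approximate_Stein_identity[OF F mean0 G V \<phi> \<psi> lin_exp'_measurable \<psi>b mono_lin_exp'[OF b] lin_exp_remainder[OF b]])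
    then have "(\<integral>w. F w * lin_exp b N (F w) \<partial>M)
        \<le> (\<integral>w. lin_exp' b N (F w) * S w + lin_exp' b N (F w) * V w \<partial>M)"
      using \<psi>S \<psi>V by simp
    also have "\<dots> \<le> (\<integral>w. b * (exp (b * F w) + \<bar>T w\<bar> * exp (b * F w) + \<bar>V w\<bar> * exp (b * F w)) \<partial>M)"
    proof (rule integral_mono)
      fix w
      have "lin_exp' b N (F w) * S w + lin_exp' b N (F w) * V w = lin_exp' b N (F w) * (S w + V w)"
        by (simp add: algebra_simps)
      also have "\<dots> \<le> lin_exp' b N (F w) * (1 + \<bar>T w\<bar> + \<bar>V w\<bar>)"
        using lin_exp'_bounds(1)[OF b] by (intro mult_left_mono) (auto simp: T_def S_def)
      also have "\<dots> \<le> b * exp (b * F w) * (1 + \<bar>T w\<bar> + \<bar>V w\<bar>)"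
        using lin_exp'_bounds(3)[OF b] by (intro mult_right_mono) auto
      finally show "lin_exp' b N (F w) * S w + lin_exp' b N (F w) * V w
          \<le> b * (exp (b * F w) + \<bar>T w\<bar> * exp (b * F w) + \<bar>V w\<bar> * exp (b * F w))"
        by (simp add: algebra_simps)
    qed (use \<psi>S \<psi>V m T1 V1 in auto)
    also have "\<dots> = b * ((\<integral>w. exp (b * F w) \<partial>M) + (\<integral>w. \<bar>T w\<bar> * exp (b * F w) \<partial>M) + (\<integral>w. \<bar>V w\<bar> * exp (b * F w) \<partial>M))"
      using m T1 V1 by simp
    also have "\<dots> \<le> b * ((\<integral>w. exp (b * F w) \<partial>M) + g1 * (\<integral>w. exp (b * F w) \<partial>M) + g2 * (\<integral>w. exp (b * F w) \<partial>M))"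
      using b T2 V2 by (intro mult_left_mono add_mono) auto
    also have "\<dots> = C" by (simp add: C_def algebra_simps)
    finally show "(\<integral>w. F w * lin_exp b N (F w) \<partial>M) \<le> C" .
  qed
  have absF: "integrable M (\<lambda>w. \<bar>F w\<bar>)" using L2_integrable[OF FL] by simp
  let ?a = "\<lambda>n w. F w * lin_exp b (real n) (F w) + \<bar>F w\<bar>"
  let ?f = "\<lambda>w. F w * exp (b * F w) + \<bar>F w\<bar>"
  have lim: "(\<lambda>n. ?a n w) \<longlonglongrightarrow> ?f w" for w
    by (intro tendsto_intros lin_exp_tendsto[OF b])
  have a0: "0 \<le> ?a n w" for n w
    by (rule id_mult_lin_exp_lower[OF b]) simp
  have f0: "0 \<le> ?f w" for w
    by (rule LIMSEQ_le_const[OF lim]) (use a0 in blast)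
  have aC: "(\<integral>\<^sup>+w. ennreal (?a n w) \<partial>M) \<le> ennreal (C + (\<integral>w. \<bar>F w\<bar> \<partial>M))" for n
  proof -
    have "(\<integral>\<^sup>+w. ennreal (?a n w) \<partial>M) = ennreal (\<integral>w. ?a n w \<partial>M)"
      using a0 int absF by (intro nn_integral_eq_integral) auto
    also have "\<dots> \<le> ennreal (C + (\<integral>w. \<bar>F w\<bar> \<partial>M))"
      using int absF le by (intro ennreal_leI) simp
    finally show ?thesis .
  qed
  have "(\<integral>\<^sup>+w. ennreal (?f w) \<partial>M) = (\<integral>\<^sup>+w. liminf (\<lambda>n. ennreal (?a n w)) \<partial>M)"
    using lim by (intro nn_integral_cong lim_imp_Liminf[symmetric] tendsto_ennrealI) auto
  also have "\<dots> \<le> liminf (\<lambda>n. \<integral>\<^sup>+w. ennreal (?a n w) \<partial>M)"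
    by (intro nn_integral_liminf) measurable
  also have "\<dots> \<le> ennreal (C + (\<integral>w. \<bar>F w\<bar> \<partial>M))"
    using aC by (intro Liminf_le) auto
  finally have fat: "(\<integral>\<^sup>+w. ennreal (?f w) \<partial>M) \<le> ennreal (C + (\<integral>w. \<bar>F w\<bar> \<partial>M))" .
  have fi: "integrable M ?f"
    using fat f0 by (intro integrableI_bounded) (auto simp: less_top[symmetric] top_unique abs_of_nonneg)
  then have "integrable M (\<lambda>w. ?f w - \<bar>F w\<bar>)" using absF by (rule Bochner_Integration.integrable_diff)
  then show Fe: "integrable M (\<lambda>w. F w * exp (b * F w))" by simp
  \<comment> \<open>\<open>ennreal\<close> maps negative reals to 0, so the bound can be read back
    in the reals only once its right side is known to be nonnegative.\<close>
  have CF: "0 \<le> C + (\<integral>w. \<bar>F w\<bar> \<partial>M)"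
  proof -
    have "0 \<le> (\<integral>w. ?a 0 w \<partial>M)" using a0[of _ 0] by (intro integral_nonneg_AE AE_I2) simp
    also have "\<dots> \<le> C + (\<integral>w. \<bar>F w\<bar> \<partial>M)" using int absF le[of 0] by simp
    finally show ?thesis .
  qed
  have "ennreal (\<integral>w. ?f w \<partial>M) \<le> ennreal (C + (\<integral>w. \<bar>F w\<bar> \<partial>M))"
    using fat f0 fi by (subst nn_integral_eq_integral[symmetric]) auto
  then have "(\<integral>w. ?f w \<partial>M) \<le> C + (\<integral>w. \<bar>F w\<bar> \<partial>M)"
    using CF by (simp add: ennreal_le_iff)
  then show "(\<integral>w. F w * exp (b * F w) \<partial>M) \<le> b * (1 + g1 + g2) * (\<integral>w. exp (b * F w) \<partial>M)"
    using Fe absF by (simp add: C_def)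
qed

end

text \<open>With \<open>j = \<lfloor>w\<rfloor>\<close>, \<open>w\<^sup>2 / 2 = j w - j\<^sup>2 / 2 + (w - j)\<^sup>2 / 2\<close> and the last term is at most \<open>1 / 2\<close>;
  this trades the Gaussian weight for exponential moments of order at most \<open>z\<close>.\<close>

lemma fz_bound_le_exponentials:
  assumes z: "0 \<le> z"
  shows "fz_bound z w \<le> (1 - Phi z) * (1 + (sqrt (2 * pi) * z * exp (1 / 2)) *
      (\<Sum>j\<le>nat \<lfloor>z\<rfloor>. exp (- (real j)\<^sup>2 / 2) * exp (real j * w))) + 2 * exp (- z\<^sup>2) * exp (z * w)"
proof -
  let ?s = "\<Sum>j\<le>nat \<lfloor>z\<rfloor>. exp (- (real j)\<^sup>2 / 2) * exp (real j * w)"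
  have s0: "0 \<le> ?s" by (intro sum_nonneg) auto
  have P: "0 \<le> 1 - Phi z" using Phi_less_1[of z] by simp
  have 1: "(if 0 < w \<and> w \<le> z then sqrt (2 * pi) * (w * exp (w\<^sup>2 / 2)) else 0) \<le> (sqrt (2 * pi) * z * exp (1 / 2)) * ?s"
  proof (cases "0 < w \<and> w \<le> z")
    case True
    define j where "j = nat \<lfloor>w\<rfloor>"
    have j: "real j \<le> w" "w \<le> real j + 1" "j \<le> nat \<lfloor>z\<rfloor>"
      using True by (auto simp: j_def nat_mono floor_mono)
    have "(w - real j)\<^sup>2 \<le> 1\<^sup>2" using j by (intro power_mono) auto
    then have "w\<^sup>2 / 2 \<le> 1 / 2 + (- (real j)\<^sup>2 / 2 + real j * w)"
      by (simp add: power2_eq_square algebra_simps)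
    then have "exp (w\<^sup>2 / 2) \<le> exp (1 / 2) * (exp (- (real j)\<^sup>2 / 2) * exp (real j * w))"
      unfolding exp_add[symmetric] by simp
    also have "\<dots> \<le> exp (1 / 2) * ?s"
      using j by (intro mult_left_mono member_le_sum) auto
    finally have "w * exp (w\<^sup>2 / 2) \<le> z * (exp (1 / 2) * ?s)"
      using True s0 by (intro mult_mono) auto
    then have "sqrt (2 * pi) * (w * exp (w\<^sup>2 / 2)) \<le> sqrt (2 * pi) * (z * (exp (1 / 2) * ?s))"
      by (intro mult_left_mono) auto
    then show ?thesis using True by (simp add: mult.assoc)
  next
    case False
    show ?thesis
      unfolding if_not_P[OF False] by (intro mult_nonneg_nonneg s0 z) auto
  qed
  \<comment> \<open>A Chernoff bound at exponent \<open>z\<close>: exp(z(w - z)) is at least 1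
    beyond \<open>z\<close>.\<close>
  have 2: "(if w > z then 2 else 0) \<le> 2 * exp (- z\<^sup>2) * exp (z * w)"
  proof -
    have "1 \<le> exp (- z\<^sup>2) * exp (z * w)" if "w > z"
      unfolding exp_add[symmetric] using that z by (simp add: power2_eq_square mult_left_mono)
    then show ?thesis by auto
  qed
  show ?thesis
    unfolding fz_bound_def using 1 2 P by (intro add_mono mult_left_mono) auto
qed

text \<open>Origin of 25: sqrt(2 pi) <= 3 and sqrt e <= 2 give 6z(z + 1) <= 9(1 + z^2) for the sum,
  and \<open>exp_le_Phi_tail\<close> gives 12(1 + z^2) for the region beyond \<open>z\<close>. The
  total 1 + 21(1 + z^2) is rounded up.\<close>

lemma fz_constants:
  assumes z: "0 \<le> z"
  shows "(1 - Phi z) * (1 + (sqrt (2 * pi) * z * exp (1 / 2)) * (real (nat \<lfloor>z\<rfloor>) + 1)) + 2 * exp (- z\<^sup>2 / 2)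
    \<le> 25 * (1 + z\<^sup>2) * (1 - Phi z)"
proof -
  have P: "0 \<le> 1 - Phi z" using Phi_less_1[of z] by simp
  have "sqrt (2 * pi) \<le> sqrt (3\<^sup>2)"
    using pi_less_4 by (intro real_sqrt_le_mono) simp
  then have s: "sqrt (2 * pi) \<le> 3" by simp
  have "exp (1 / 2) * exp (1 / 2) = exp (1::real)"
    unfolding exp_add[symmetric] by simp
  then have "(exp (1 / 2))\<^sup>2 \<le> (2::real)\<^sup>2"
    using exp_le by (simp add: power2_eq_square)
  then have e: "exp (1 / 2) \<le> (2::real)"
    by (rule power2_le_imp_le) simp
  have fl: "real (nat \<lfloor>z\<rfloor>) + 1 \<le> z + 1" using z by simp
  have "(sqrt (2 * pi) * z * exp (1 / 2)) * (real (nat \<lfloor>z\<rfloor>) + 1) \<le> (3 * z * 2) * (z + 1)"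
    using s e fl z by (intro mult_mono) auto
  also have "\<dots> \<le> 9 * (1 + z\<^sup>2)"
    using zero_le_power2[of "z - 1"] by (simp add: power2_eq_square algebra_simps)
  finally have 1: "(1 - Phi z) * (1 + (sqrt (2 * pi) * z * exp (1 / 2)) * (real (nat \<lfloor>z\<rfloor>) + 1))
      \<le> (1 - Phi z) * (1 + 9 * (1 + z\<^sup>2))"
    using P by (intro mult_left_mono) auto
  have "2 * exp (- z\<^sup>2 / 2) \<le> 2 * (2 * sqrt (2 * pi) * (1 + z\<^sup>2) * (1 - Phi z))"
    by (intro mult_left_mono exp_le_Phi_tail z) simp
  also have "\<dots> \<le> 2 * (2 * 3 * (1 + z\<^sup>2) * (1 - Phi z))"
    using s P by (intro mult_left_mono mult_right_mono) auto
  also have "\<dots> = (1 - Phi z) * (12 * (1 + z\<^sup>2))"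
    by simp
  finally have 2: "2 * exp (- z\<^sup>2 / 2) \<le> (1 - Phi z) * (12 * (1 + z\<^sup>2))" .
  have "(1 - Phi z) * (1 + 9 * (1 + z\<^sup>2)) + (1 - Phi z) * (12 * (1 + z\<^sup>2))
      = (1 - Phi z) * (1 + 21 * (1 + z\<^sup>2))"
    by (simp add: algebra_simps)
  also have "\<dots> \<le> (1 - Phi z) * (25 * (1 + z\<^sup>2))"
    using P by (intro mult_left_mono) auto
  finally show ?thesis using 1 2 by (simp add: mult_ac)
qed

context rademacher
begin

text \<open>The weights exp(-j^2/2) cancel the growth allowed by \<open>le\<close>, so each of the
  floor(z) + 1 exponentials costs the same amount \<open>g * exp d0\<close>. The lemma is meant for
  \<open>W\<close> equal to |T| and to |V|.\<close>

lemma weighted_fz_bound: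
  assumes z: "0 \<le> z" and g: "0 \<le> g"
    and [measurable]: "F \<in> borel_measurable M" "W \<in> borel_measurable M"
    and W0: "\<And>w. 0 \<le> W w"
    and int: "\<And>t. 0 \<le> t \<Longrightarrow> t \<le> z \<Longrightarrow> integrable M (\<lambda>w. W w * exp (t * F w))"
    and le: "\<And>t. 0 \<le> t \<Longrightarrow> t \<le> z \<Longrightarrow> (\<integral>w. W w * exp (t * F w) \<partial>M) \<le> g * (exp d0 * exp (t\<^sup>2 / 2))"
  shows "integrable M (\<lambda>w. W w * fz_bound z (F w))"
    and "(\<integral>w. W w * fz_bound z (F w) \<partial>M) \<le> 25 * exp d0 * (1 + z\<^sup>2) * g * (1 - Phi z)"
proof -
  let ?J = "{..nat \<lfloor>z\<rfloor>}" and ?c = "sqrt (2 * pi) * z * exp (1 / 2)"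
  let ?h = "\<lambda>w. (1 - Phi z) * (W w * exp (0 * F w) + ?c * (\<Sum>j\<in>?J. exp (- (real j)\<^sup>2 / 2) * (W w * exp (real j * F w))))
      + 2 * exp (- z\<^sup>2) * (W w * exp (z * F w))"
  have P: "0 \<le> 1 - Phi z" using Phi_less_1[of z] by simp
  have jz: "real j \<le> z" if "j \<in> ?J" for j
    using that z by (simp add: le_nat_iff le_floor_iff)
  have ij: "integrable M (\<lambda>w. W w * exp (real j * F w))" if "j \<in> ?J" for j
    using jz[OF that] by (intro int) auto
  have i0: "integrable M (\<lambda>w. W w * exp (0 * F w))" and iz: "integrable M (\<lambda>w. W w * exp (z * F w))"
    using z by (intro int; simp)+
  have isum: "integrable M (\<lambda>w. \<Sum>j\<in>?J. exp (- (real j)\<^sup>2 / 2) * (W w * exp (real j * F w)))"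
    by (intro Bochner_Integration.integrable_sum integrable_mult_right ij)
  have hint: "integrable M ?h"
    by (intro Bochner_Integration.integrable_add integrable_mult_right i0 iz isum)
  have ptw: "W w * fz_bound z (F w) \<le> ?h w" for w
    using mult_left_mono[OF fz_bound_le_exponentials[OF z, of "F w"] W0[of w]]
    by (simp add: algebra_simps sum_distrib_left)
  have nn: "0 \<le> W w * fz_bound z (F w)" for w
    using W0 P order.trans[OF abs_ge_zero fz'_fzH_bound(1)[OF z]] by (intro mult_nonneg_nonneg) auto
  have [measurable]: "fz_bound z \<in> borel_measurable borel"
    unfolding fz_bound_def[abs_def] by measurable
  show fi: "integrable M (\<lambda>w. W w * fz_bound z (F w))"
    by (rule Bochner_Integration.integrable_bound[OF hint])
       (auto simp only: real_norm_def abs_of_nonneg[OF nn] intro!: AE_I2 order.trans[OF ptw abs_ge_self], measurable)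
  have "(\<integral>w. W w * fz_bound z (F w) \<partial>M) \<le> (\<integral>w. ?h w \<partial>M)"
    by (intro integral_mono fi hint ptw)
  also have "\<dots> = (1 - Phi z) * ((\<integral>w. W w * exp (0 * F w) \<partial>M)
        + ?c * (\<Sum>j\<in>?J. exp (- (real j)\<^sup>2 / 2) * (\<integral>w. W w * exp (real j * F w) \<partial>M)))
      + 2 * exp (- z\<^sup>2) * (\<integral>w. W w * exp (z * F w) \<partial>M)"
  proof -
    have "(\<integral>w. (\<Sum>j\<in>?J. exp (- (real j)\<^sup>2 / 2) * (W w * exp (real j * F w))) \<partial>M)
        = (\<Sum>j\<in>?J. exp (- (real j)\<^sup>2 / 2) * (\<integral>w. W w * exp (real j * F w) \<partial>M))"
      by (subst Bochner_Integration.integral_sum) (auto intro!: integrable_mult_right ij)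
    then show ?thesis
      using i0 iz isum by (simp only: Bochner_Integration.integral_add integrable_mult_right
          Bochner_Integration.integrable_add integral_mult_right_zero)
  qed
  also have "\<dots> \<le> (1 - Phi z) * (g * exp d0 + ?c * (\<Sum>j\<in>?J. g * exp d0))
      + 2 * exp (- z\<^sup>2) * (g * (exp d0 * exp (z\<^sup>2 / 2)))"
  proof (intro add_mono mult_left_mono sum_mono)
    show "(\<integral>w. W w * exp (0 * F w) \<partial>M) \<le> g * exp d0"
      using le[of 0] z by simp
    show "(\<integral>w. W w * exp (z * F w) \<partial>M) \<le> g * (exp d0 * exp (z\<^sup>2 / 2))"
      using z by (intro le) auto
    show "exp (- (real j)\<^sup>2 / 2) * (\<integral>w. W w * exp (real j * F w) \<partial>M) \<le> g * exp d0" if "j \<in> ?J" for j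
    proof -
      have "exp (- (real j)\<^sup>2 / 2) * (\<integral>w. W w * exp (real j * F w) \<partial>M)
          \<le> exp (- (real j)\<^sup>2 / 2) * (g * (exp d0 * exp ((real j)\<^sup>2 / 2)))"
        using jz[OF that] by (intro mult_left_mono le) auto
      also have "\<dots> = g * exp d0 * (exp (- (real j)\<^sup>2 / 2) * exp ((real j)\<^sup>2 / 2))"
        by (simp only: mult_ac)
      also have "\<dots> = g * exp d0" unfolding exp_add[symmetric] by simp
      finally show ?thesis .
    qed
  qed (use z P in auto)
  also have "\<dots> = (g * exp d0) * ((1 - Phi z) * (1 + ?c * (real (nat \<lfloor>z\<rfloor>) + 1)) + 2 * exp (- z\<^sup>2 / 2))"
  proof -
    have "2 * exp (- z\<^sup>2) * (g * (exp d0 * exp (z\<^sup>2 / 2))) = (g * exp d0) * (2 * (exp (- z\<^sup>2) * exp (z\<^sup>2 / 2)))"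
      by (simp only: mult_ac)
    also have "exp (- z\<^sup>2) * exp (z\<^sup>2 / 2) = exp (- z\<^sup>2 / 2)"
      unfolding exp_add[symmetric] by simp
    finally have E: "2 * exp (- z\<^sup>2) * (g * (exp d0 * exp (z\<^sup>2 / 2))) = (g * exp d0) * (2 * exp (- z\<^sup>2 / 2))" .
    show ?thesis unfolding E by (simp add: algebra_simps)
  qed
  also have "\<dots> \<le> (g * exp d0) * (25 * (1 + z\<^sup>2) * (1 - Phi z))"
    using g by (intro mult_left_mono fz_constants[OF z]) auto
  finally show "(\<integral>w. W w * fz_bound z (F w) \<partial>M) \<le> 25 * exp d0 * (1 + z\<^sup>2) * g * (1 - Phi z)"
    by (simp only: mult_ac)
qed

text \<open>The tangent to exp at the right endpoint gives exp(bF) - exp(aF) <= (b - a) F exp(bF).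
  Its expectation is the step inequality of \<open>exp_quadratic_Gronwall\<close>.\<close>

lemma mgf_bound:
  fixes F :: "(nat \<Rightarrow> real) \<Rightarrow> real"
  assumes z: "0 \<le> z" and K: "0 \<le> K"
    and m: "\<And>t. 0 \<le> t \<Longrightarrow> t \<le> z \<Longrightarrow> integrable M (\<lambda>w. exp (t * F w))"
    and i: "\<And>t. 0 \<le> t \<Longrightarrow> t \<le> z \<Longrightarrow> integrable M (\<lambda>w. F w * exp (t * F w))"
    and d: "\<And>t. 0 \<le> t \<Longrightarrow> t \<le> z \<Longrightarrow> (\<integral>w. F w * exp (t * F w) \<partial>M) \<le> t * K * (\<integral>w. exp (t * F w) \<partial>M)"
  shows "(\<integral>w. exp (z * F w) \<partial>M) \<le> exp (K * z\<^sup>2 / 2)"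
proof (rule exp_quadratic_Gronwall[where m="\<lambda>t. \<integral>w. exp (t * F w) \<partial>M", OF z K])
  show "(\<integral>w. exp (0 * F w) \<partial>M) \<le> 1" using prob_space by simp
  fix a b assume ab: "0 \<le> a" "a \<le> b" "b \<le> z"
  have "(\<integral>w. exp (b * F w) \<partial>M) - (\<integral>w. exp (a * F w) \<partial>M) = (\<integral>w. exp (b * F w) - exp (a * F w) \<partial>M)"
    using m[of a] m[of b] ab by simp
  also have "\<dots> \<le> (\<integral>w. (b - a) * (F w * exp (b * F w)) \<partial>M)"
  proof (rule integral_mono)
    fix w
    have "exp (b * F w) * (1 + (a - b) * F w) \<le> exp (b * F w) * exp ((a - b) * F w)"
      by (intro mult_left_mono exp_ge_add_one_self) simp
    also have "\<dots> = exp (a * F w)"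
      unfolding exp_add[symmetric] by (simp add: algebra_simps)
    finally show "exp (b * F w) - exp (a * F w) \<le> (b - a) * (F w * exp (b * F w))"
      by (simp add: algebra_simps)
  qed (use m[of a] m[of b] i[of b] ab in auto)
  also have "\<dots> = (b - a) * (\<integral>w. F w * exp (b * F w) \<partial>M)" by simp
  also have "\<dots> \<le> (b - a) * (b * K * (\<integral>w. exp (b * F w) \<partial>M))"
    using ab by (intro mult_left_mono d) auto
  finally show "(\<integral>w. exp (b * F w) \<partial>M) - (\<integral>w. exp (a * F w) \<partial>M) \<le> (b - a) * (b * K * (\<integral>w. exp (b * F w) \<partial>M))" .
qed simp

end

section \<open>Moderate deviations\<close>

text \<open>L^{-1}F and delta(u) are determined only almost surely; \<open>G\<close> and
  \<open>V\<close> are arbitrary versions of them, and \<open>a0\<close> is the maximum defining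
  A_0(d_0).\<close>

theorem theorem3p1:
  fixes p :: "nat \<Rightarrow> real"
    and F G V :: "(nat \<Rightarrow> real) \<Rightarrow> real"
    and A d0 a0 z :: real
    and \<gamma>1 \<gamma>2 :: "real \<Rightarrow> real"
  defines "M \<equiv> RadM p"
    and "u \<equiv> (\<lambda>k \<omega>. (1 / sqrt (p k * qq p k)) * Dk p k F \<omega> * \<bar>Dk p k G \<omega>\<bar>)"
  assumes p: "\<And>k. 0 < p k \<and> p k < 1"
    and F_D12: "F \<in> D12 p"
    and mean0: "(\<integral>\<omega>. F \<omega> \<partial>M) = 0"
    and var1: "(\<integral>\<omega>. (F \<omega> - (\<integral>\<omega>'. F \<omega>' \<partial>M))\<^sup>2 \<partial>M) = 1"
    and stein_D12: "\<And>z'. (\<lambda>\<omega>. F \<omega> * fz z' (F \<omega>) + (if F \<omega> > z' then 1 else 0)) \<in> D12 p"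
    and Linv: "is_Linv p F G"
    and delta: "is_delta p u V"
    and Apos: "A > 0"
    and mono1: "mono_on {0..A} \<gamma>1"
    and mono2: "mono_on {0..A} \<gamma>2"
    and expint: "\<And>t. 0 \<le> t \<Longrightarrow> t \<le> A \<Longrightarrow> integrable M (\<lambda>\<omega>. exp (t * F \<omega>))"
    and A1: "\<And>t. 0 \<le> t \<Longrightarrow> t \<le> A \<Longrightarrow>
       integrable M (\<lambda>\<omega>. \<bar>1 - (\<Sum>k. Dk p k F \<omega> * (- Dk p k G \<omega>))\<bar> * exp (t * F \<omega>)) \<and>
       (\<integral>\<omega>. \<bar>1 - (\<Sum>k. Dk p k F \<omega> * (- Dk p k G \<omega>))\<bar> * exp (t * F \<omega>) \<partial>M)
         \<le> \<gamma>1 t * (\<integral>\<omega>. exp (t * F \<omega>) \<partial>M)"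
    and A2: "\<And>t. 0 \<le> t \<Longrightarrow> t \<le> A \<Longrightarrow>
       integrable M (\<lambda>\<omega>. \<bar>V \<omega>\<bar> * exp (t * F \<omega>)) \<and>
       (\<integral>\<omega>. \<bar>V \<omega>\<bar> * exp (t * F \<omega>) \<partial>M) \<le> \<gamma>2 t * (\<integral>\<omega>. exp (t * F \<omega>) \<partial>M)"
    and d0: "d0 \<ge> 0"
    and a0_mem: "a0 \<in> A0set A \<gamma>1 \<gamma>2 d0"
    and a0_max: "\<forall>t \<in> A0set A \<gamma>1 \<gamma>2 d0. t \<le> a0"
    and z: "0 \<le> z" "z \<le> a0"
  shows "\<bar>measure M {\<omega> \<in> space M. F \<omega> > z} / (1 - Phi z) - 1\<bar>
           \<le> 25 * exp d0 * (1 + z\<^sup>2) * (\<gamma>1 z + \<gamma>2 z)"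
proof -
  interpret rademacher p by unfold_locales (use p in auto)
  let ?m = "\<lambda>t. \<integral>w. exp (t * F w) \<partial>M" and ?g = "\<gamma>1 z + \<gamma>2 z"
  define T where "T = (\<lambda>w. 1 - (\<Sum>k. Dk p k F w * - Dk p k G w))"
  have a0: "0 \<le> a0" "a0 \<le> A" "a0\<^sup>2 / 2 * (\<gamma>1 a0 + \<gamma>2 a0) \<le> d0"
    using a0_mem by (auto simp: A0set_def)
  have zA: "z \<le> A" using z a0 by simp
  have FL: "F \<in> L2" using F_D12 by (simp add: D12_iff)
  have GD: "G \<in> D12 p" by (rule Linv_D12[OF FL Linv])
  have Fm[measurable]: "F \<in> borel_measurable (RadM p)" using FL by (simp add: L2_def)
  have Vm[measurable]: "V \<in> borel_measurable (RadM p)" and VL: "V \<in> L2"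
    using delta by (auto simp: is_delta_def L2_def)
  have Si: "integrable (RadM p) (\<lambda>w. \<Sum>k. Dk p k F w * - Dk p k G w)"
    using F_D12 GD by (intro L2_seq_inner_integrable L2_seq_uminus) (auto simp: D12_iff)
  then have Ti: "integrable (RadM p) T" by (simp add: T_def)
  then have Tm[measurable]: "T \<in> borel_measurable (RadM p)" by auto
  note delta' = delta[unfolded u_def]
  have m_pos: "0 < ?m t" if "0 \<le> t" "t \<le> A" for t
    using expint[OF that] unfolding M_def by (intro expectation_greater) auto
  have T1: "integrable (RadM p) (\<lambda>w. \<bar>T w\<bar> * exp (t * F w))"
    and T2: "(\<integral>w. \<bar>T w\<bar> * exp (t * F w) \<partial>RadM p) \<le> \<gamma>1 t * ?m t" if "0 \<le> t" "t \<le> A" for t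
    using A1[OF that] by (auto simp: T_def M_def)
  have V1: "integrable (RadM p) (\<lambda>w. \<bar>V w\<bar> * exp (t * F w))"
    and V2: "(\<integral>w. \<bar>V w\<bar> * exp (t * F w) \<partial>RadM p) \<le> \<gamma>2 t * ?m t" if "0 \<le> t" "t \<le> A" for t
    using A2[OF that] by (auto simp: M_def)
  \<comment> \<open>Nonnegativity is forced by (A1) and (A2): their left sides are nonnegative and
    the exponential moment is positive.\<close>
  have g_nonneg: "0 \<le> \<gamma>1 t" "0 \<le> \<gamma>2 t" if "0 \<le> t" "t \<le> A" for t
  proof -
    have "0 \<le> \<gamma>1 t * ?m t"
      by (rule order.trans[OF _ T2[OF that]]) (auto intro!: integral_nonneg_AE)
    moreover have "0 \<le> \<gamma>2 t * ?m t"
      by (rule order.trans[OF _ V2[OF that]]) (auto intro!: integral_nonneg_AE)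
    ultimately show "0 \<le> \<gamma>1 t" "0 \<le> \<gamma>2 t"
      using m_pos[OF that] by (auto simp: zero_le_mult_iff)
  qed
  have g_mono: "\<gamma>1 s \<le> \<gamma>1 t" "\<gamma>2 s \<le> \<gamma>2 t" if "0 \<le> s" "s \<le> t" "t \<le> A" for s t
    using that by (auto intro!: mono_onD[OF mono1] mono_onD[OF mono2])
  have mgf: "?m t \<le> exp d0 * exp (t\<^sup>2 / 2)" if t: "0 \<le> t" "t \<le> z" for t
  proof -
    have d: "integrable (RadM p) (\<lambda>w. F w * exp (s * F w))"
      "(\<integral>w. F w * exp (s * F w) \<partial>RadM p) \<le> s * (1 + ?g) * (\<integral>w. exp (s * F w) \<partial>RadM p)"
      if s: "0 \<le> s" "s \<le> t" for s
    proof -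
      have sA: "s \<le> A" "s \<le> z" using s t zA by auto
      note b = mgf_derivative_bound[OF F_D12 mean0[unfolded M_def] Linv delta' s(1)
          expint[OF s(1) sA(1), unfolded M_def] T1[OF s(1) sA(1), unfolded T_def] T2[OF s(1) sA(1), unfolded T_def M_def]
          V1[OF s(1) sA(1)] V2[OF s(1) sA(1), unfolded M_def]]
      show "integrable (RadM p) (\<lambda>w. F w * exp (s * F w))" by (rule b(1))
      note b(2)
      \<comment> \<open>Monotonicity freezes both rates at \<open>z\<close>, giving the constant
        \<open>K = 1 + ?g\<close> that \<open>mgf_bound\<close> needs.\<close>
      also have "s * (1 + \<gamma>1 s + \<gamma>2 s) * (\<integral>w. exp (s * F w) \<partial>RadM p)
          \<le> s * (1 + ?g) * (\<integral>w. exp (s * F w) \<partial>RadM p)"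
        using s g_mono[OF s(1) sA(2) zA] by (intro mult_right_mono mult_left_mono integral_nonneg_AE) auto
      finally show "(\<integral>w. F w * exp (s * F w) \<partial>RadM p) \<le> s * (1 + ?g) * (\<integral>w. exp (s * F w) \<partial>RadM p)" .
    qed
    have "?m t \<le> exp ((1 + ?g) * t\<^sup>2 / 2)"
      unfolding M_def
    proof (rule mgf_bound[OF t(1)])
      show "0 \<le> 1 + ?g" using g_nonneg[OF z(1) zA] by simp
      show "integrable (RadM p) (\<lambda>w. exp (s * F w))" if "0 \<le> s" "s \<le> t" for s
        using expint[of s] that t zA by (simp add: M_def)
    qed (rule d, assumption+)+
    \<comment> \<open>Since \<open>t \<le> z \<le> a0\<close>, the excess over t^2/2 is at most the
      corresponding expression at \<open>a0\<close>, which membership in \<open>A0set\<close> bounds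
      by \<open>d0\<close>.\<close>
    also have "\<dots> \<le> exp (d0 + t\<^sup>2 / 2)"
    proof -
      have "t\<^sup>2 / 2 * ?g \<le> a0\<^sup>2 / 2 * (\<gamma>1 a0 + \<gamma>2 a0)"
        using t z a0 g_mono[OF z(1) z(2) a0(2)] g_nonneg[OF z(1) zA]
        by (intro mult_mono add_mono divide_right_mono power_mono) auto
      then have "t\<^sup>2 / 2 * ?g \<le> d0" using a0 by simp
      then show ?thesis by (simp add: algebra_simps)
    qed
    finally show ?thesis by (simp add: exp_add)
  qed
  have tA: "t \<le> A" if "t \<le> z" for t using that zA by simp
  have T3: "(\<integral>w. \<bar>T w\<bar> * exp (t * F w) \<partial>RadM p) \<le> \<gamma>1 z * (exp d0 * exp (t\<^sup>2 / 2))"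
    and V3: "(\<integral>w. \<bar>V w\<bar> * exp (t * F w) \<partial>RadM p) \<le> \<gamma>2 z * (exp d0 * exp (t\<^sup>2 / 2))"
    if t: "0 \<le> t" "t \<le> z" for t
  proof -
    note tA = tA[OF t(2)]
    have "\<gamma>1 t * ?m t \<le> \<gamma>1 z * (exp d0 * exp (t\<^sup>2 / 2))" "\<gamma>2 t * ?m t \<le> \<gamma>2 z * (exp d0 * exp (t\<^sup>2 / 2))"
      using mgf[OF t] g_mono[OF t zA] g_nonneg[OF z(1) zA] less_imp_le[OF m_pos[OF t(1) tA]]
      by (intro mult_mono; simp)+
    then show "(\<integral>w. \<bar>T w\<bar> * exp (t * F w) \<partial>RadM p) \<le> \<gamma>1 z * (exp d0 * exp (t\<^sup>2 / 2))"
      "(\<integral>w. \<bar>V w\<bar> * exp (t * F w) \<partial>RadM p) \<le> \<gamma>2 z * (exp d0 * exp (t\<^sup>2 / 2))"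
      using T2[OF t(1) tA] V2[OF t(1) tA] by linarith+
  qed
  have TB: "integrable (RadM p) (\<lambda>w. \<bar>T w\<bar> * fz_bound z (F w))"
    "(\<integral>w. \<bar>T w\<bar> * fz_bound z (F w) \<partial>RadM p) \<le> 25 * exp d0 * (1 + z\<^sup>2) * \<gamma>1 z * (1 - Phi z)"
    by (rule weighted_fz_bound[OF z(1) g_nonneg(1)[OF z(1) zA] Fm borel_measurable_abs[OF Tm] abs_ge_zero];
        (rule T1[OF _ tA] T3; assumption))+
  have VB: "integrable (RadM p) (\<lambda>w. \<bar>V w\<bar> * fz_bound z (F w))"
    "(\<integral>w. \<bar>V w\<bar> * fz_bound z (F w) \<partial>RadM p) \<le> 25 * exp d0 * (1 + z\<^sup>2) * \<gamma>2 z * (1 - Phi z)"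
    by (rule weighted_fz_bound[OF z(1) g_nonneg(2)[OF z(1) zA] Fm borel_measurable_abs[OF Vm] abs_ge_zero];
        (rule V1[OF _ tA] V3; assumption))+
  have \<phi>: "(\<lambda>w. fz z (F w)) \<in> D12 p"
    by (rule D12_lipschitz[OF F_D12 fz_measurable fz_lipschitz[OF z(1)]])
  \<comment> \<open>\<open>fzH\<close> jumps at \<open>z\<close>, so \<open>D12_lipschitz\<close>
    cannot supply this membership; it comes from the hypothesis on F f_z(F) + 1{F > z}.\<close>
  have H: "(\<lambda>w. fzH z (F w)) \<in> D12 p"
    using stein_D12[of z] by (simp add: fzH_def)
  have \<psi>b: "\<bar>fz' z x\<bar> \<le> 3 + sqrt (2 * pi) * (z * exp (z\<^sup>2 / 2))" for x
    by (rule order.trans[OF fz'_fzH_bound(1)[OF z(1)] fz_bound_bounded[OF z(1)]])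
  have stein: "\<bar>(\<integral>w. F w * fz z (F w) \<partial>RadM p) - (\<integral>w. fz' z (F w) * (1 - T w) \<partial>RadM p)\<bar>
      \<le> (\<integral>w. fzH z (F w) * V w \<partial>RadM p)"
    using approximate_Stein_identity[OF F_D12 mean0[unfolded M_def] Linv delta' \<phi> H fz'_measurable \<psi>b mono_fzH fz_remainder]
    by (simp add: T_def)
  have Ffz: "integrable (RadM p) (\<lambda>w. F w * fz z (F w))"
    using FL \<phi> by (intro L2_mult_integrable) (auto simp: D12_iff)
  have \<psi>i: "integrable (RadM p) (\<lambda>w. fz' z (F w))"
    using \<psi>b by (intro integrable_const_bound[of _ "3 + sqrt (2 * pi) * (z * exp (z\<^sup>2 / 2))"]) auto
  have \<psi>T: "integrable (RadM p) (\<lambda>w. fz' z (F w) * T w)"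
  proof (rule Bochner_Integration.integrable_bound[OF TB(1)])
    have "\<bar>T w\<bar> * \<bar>fz' z (F w)\<bar> \<le> \<bar>T w\<bar> * \<bar>fz_bound z (F w)\<bar>" for w
      by (intro mult_left_mono order.trans[OF fz'_fzH_bound(1)[OF z(1)] abs_ge_self]) simp
    then show "AE w in RadM p. norm (fz' z (F w) * T w) \<le> norm (\<bar>T w\<bar> * fz_bound z (F w))"
      by (simp add: abs_mult mult.commute)
  qed (intro borel_measurable_times measurable_compose[OF Fm fz'_measurable] Tm)
  let ?P = "measure M {w \<in> space M. F w > z}"
  have P: "(\<integral>w. (if F w > z then 1 else 0) \<partial>RadM p) = ?P"
  proof -
    have "(\<integral>w. (if F w > z then 1 else 0) \<partial>RadM p) = (\<integral>w. indicator {w \<in> space (RadM p). F w > z} w \<partial>RadM p)"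
      by (intro Bochner_Integration.integral_cong) (auto simp: indicator_def)
    also have "\<dots> = measure (RadM p) ({w \<in> space (RadM p). F w > z} \<inter> space (RadM p))"
      by (rule Bochner_Integration.integral_indicator)
    also have "{w \<in> space (RadM p). F w > z} \<inter> space (RadM p) = {w \<in> space (RadM p). F w > z}" by auto
    finally show ?thesis by (simp only: M_def)
  qed
  \<comment> \<open>The Stein equation in terms of upper tails; its expectation expresses the tail
    difference through \<open>F\<close>.\<close>
  have "fz' z x - x * fz z x = (1 - Phi z) - (if x > z then 1 else 0)" for x
    by (simp add: fz'_def)
  then have "(\<integral>w. fz' z (F w) - F w * fz z (F w) \<partial>RadM p) = (\<integral>w. (1 - Phi z) - (if F w > z then 1 else 0) \<partial>RadM p)"
    by simp
  also have "\<dots> = (1 - Phi z) - ?P"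
    unfolding P[symmetric] using prob_space
    by (subst Bochner_Integration.integral_diff) (auto intro!: integrable_const_bound[of _ 1])
  finally have "?P - (1 - Phi z) = (\<integral>w. F w * fz z (F w) \<partial>RadM p) - (\<integral>w. fz' z (F w) \<partial>RadM p)"
    using \<psi>i Ffz by simp
  \<comment> \<open>Splitting 1 = (1 - T) + T isolates the part handled by \<open>stein\<close> from
    the error weighted by T.\<close>
  also have "(\<integral>w. fz' z (F w) \<partial>RadM p) = (\<integral>w. fz' z (F w) * (1 - T w) \<partial>RadM p) + (\<integral>w. fz' z (F w) * T w \<partial>RadM p)"
    using \<psi>i \<psi>T by (simp add: right_diff_distrib)
  finally have "\<bar>?P - (1 - Phi z)\<bar> \<le> (\<integral>w. fzH z (F w) * V w \<partial>RadM p) + \<bar>\<integral>w. fz' z (F w) * T w \<partial>RadM p\<bar>"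
    using stein by linarith
  also have "(\<integral>w. fzH z (F w) * V w \<partial>RadM p) \<le> (\<integral>w. \<bar>V w\<bar> * fz_bound z (F w) \<partial>RadM p)"
  proof (rule integral_mono)
    show "integrable (RadM p) (\<lambda>w. fzH z (F w) * V w)"
      using H VL by (intro L2_mult_integrable) (auto simp: D12_iff)
    fix w
    have "fzH z (F w) * V w \<le> \<bar>fzH z (F w)\<bar> * \<bar>V w\<bar>" by (simp add: abs_mult[symmetric])
    also have "\<dots> \<le> fz_bound z (F w) * \<bar>V w\<bar>"
      by (intro mult_right_mono fz'_fzH_bound(2) z) simp
    finally show "fzH z (F w) * V w \<le> \<bar>V w\<bar> * fz_bound z (F w)" by (simp add: mult.commute)
  qed (rule VB)
  also have "\<bar>\<integral>w. fz' z (F w) * T w \<partial>RadM p\<bar> \<le> (\<integral>w. \<bar>fz' z (F w) * T w\<bar> \<partial>RadM p)"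
    by (rule integral_abs_bound)
  also have "\<dots> \<le> (\<integral>w. \<bar>T w\<bar> * fz_bound z (F w) \<partial>RadM p)"
  proof (rule integral_mono)
    show "\<bar>fz' z (F w) * T w\<bar> \<le> \<bar>T w\<bar> * fz_bound z (F w)" for w
      unfolding abs_mult mult.commute[of "\<bar>fz' z _\<bar>"] by (intro mult_left_mono fz'_fzH_bound(1) z) simp
  qed (use \<psi>T TB in auto)
  finally have "\<bar>?P - (1 - Phi z)\<bar> \<le> 25 * exp d0 * (1 + z\<^sup>2) * ?g * (1 - Phi z)"
    using TB(2) VB(2) by (simp add: algebra_simps)
  moreover have pos: "0 < 1 - Phi z" using Phi_less_1[of z] by simp
  moreover have "?P / (1 - Phi z) - 1 = (?P - (1 - Phi z)) / (1 - Phi z)"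
    using pos by (simp add: diff_divide_distrib)
  ultimately show ?thesis
    by (simp add: abs_divide pos_divide_le_eq)
qed

end
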